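(* Let $P\in\mathcal C\langle X\rangle$ be a quasi-identity of $M_n$ and let $c\in F\langle X\rangle$ be a central polynomial of $M_n$ with zero constant term. Then there exists $m\in\mathbb N$ such that $c^mP$ is a consequence of the Cayley–Hamilton identity, i.e. $c^mP\in(Q_n)$.
   Context: Let $F$ be a field of characteristic $0$, $n\ge1$, $M_n=M_n(F)$. Let $\mathcal C=F[x^{(k)}_{ij}:1\le i,j\le n,\ k\ge1]$, $X=\{x_1,x_2,\dots\}$ noncommuting indeterminates, $\mathcal C\langle X\rangle$ the free $\mathcal C$-algebra (quasi-polynomials), containing the free algebra $F\langle X\rangle$. Evaluation at $A_k=(a^{(k)}_{ij})\in M_n$ substitutes $A_k$ for $x_k$ and $a^{(k)}_{ij}$ for $x^{(k)}_{ij}$; a quasi-identity vanishes at all evaluations. A central polynomial of $M_n$ is $c\in F\langle X\rangle$ all of whose evaluations in $M_n$ are scalar matrices. Generic matrices $\xi_k=(x^{(k)}_{ij})\in M_n(\mathcal C)$; for monomials $\mathrm{tr}(x_{i_1}\cdots x_{i_r}):=\mathrm{tr}(\xi_{i_1}\cdots\xi_{i_r})\in\mathcal C$. $Q_n=\sum_{\sigma\in S_{n+1}}\epsilon_\sigma\phi_\sigma(x_1,\dots,x_n)$, where for $\sigma=(i_1,\dots,i_{k_1})\cdots(u_1,\dots,u_h)(s_1,\dots,s_k,n+1)$ (disjoint cycles, the one containing $n+1$ last) $\phi_\sigma=\mathrm{tr}(x_{i_1}\cdots x_{i_{k_1}})\cdots\mathrm{tr}(x_{u_1}\cdots x_{u_h})x_{s_1}\cdots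 x_{s_k}$. A T-ideal is an ideal of $\mathcal C\langle X\rangle$ closed under all simultaneous substitutions $x_k\mapsto H_k$, $x^{(k)}_{ij}\mapsto\Phi(H_k)_{ij}$, where $\Phi:\mathcal C\langle X\rangle\to M_n(\mathcal C)$ is the $\mathcal C$-algebra map with $x_k\mapsto\xi_k$; $(Q_n)$ is the T-ideal generated by $Q_n$. *)

theory Defs
  imports "Jordan_Normal_Form.Matrix" "HOL-Library.Poly_Mapping" "HOL-Combinatorics.Permutations"
begin

datatype word = Word "nat list"

fun word_list :: "word \<Rightarrow> nat list" where "word_list (Word ws) = ws"

instantiation word :: monoid_add
begin
definition zero_word :: word where "zero_word = Word []"
definition plus_word :: "word \<Rightarrow> word \<Rightarrow> word" where
  "plus_word u v = Word (word_list u @ word_list v)"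
instance
proof
  fix a b c :: word
  show "a + b + c = a + (b + c)" by (cases a; cases b; cases c) (simp add: plus_word_def)
  show "0 + a = a" by (cases a) (simp add: plus_word_def zero_word_def)
  show "a + 0 = a" by (cases a) (simp add: plus_word_def zero_word_def)
qed
end

text \<open>Commutative variable (k,i,j) stands for x^(k)_ij (0-based indices).
  A commutative monomial is a finitely supported exponent vector.\<close>
type_synonym cmon = "(nat \<times> nat \<times> nat) \<Rightarrow>\<^sub>0 nat"
type_synonym 'a cpoly = "cmon \<Rightarrow>\<^sub>0 'a"
type_synonym 'a qpoly = "word \<Rightarrow>\<^sub>0 'a cpoly"

definition cvar :: "nat \<times> nat \<times> nat \<Rightarrow> 'a::zero_neq_one cpoly" where
  "cvar v = Poly_Mapping.single (Poly_Mapping.single v 1) 1"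

definition cconst :: "'a::zero \<Rightarrow> 'a cpoly" where
  "cconst a = Poly_Mapping.single 0 a"

definition qconst :: "'a::zero cpoly \<Rightarrow> 'a qpoly" where
  "qconst c = Poly_Mapping.single 0 c"

definition qvar :: "nat \<Rightarrow> 'a::zero_neq_one qpoly" where
  "qvar k = Poly_Mapping.single (Word [k]) 1"

definition wf_qpoly :: "nat \<Rightarrow> 'a::zero qpoly \<Rightarrow> bool" where
  "wf_qpoly n p \<longleftrightarrow> (\<forall>w \<in> Poly_Mapping.keys p. \<forall>mo \<in> Poly_Mapping.keys (Poly_Mapping.lookup p w). \<forall>v \<in> Poly_Mapping.keys mo.
      fst (snd v) < n \<and> snd (snd v) < n)"

definition in_free_alg :: "'a::zero qpoly \<Rightarrow> bool" where
  "in_free_alg p \<longleftrightarrow> (\<forall>w. Poly_Mapping.keys (Poly_Mapping.lookup p w) \<subseteq> {0})"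

definition mtrace :: "nat \<Rightarrow> 'a::comm_monoid_add mat \<Rightarrow> 'a" where
  "mtrace n M = (\<Sum>i<n. M $$ (i,i))"

definition word_mat :: "nat \<Rightarrow> (nat \<Rightarrow> 'a::semiring_1 mat) \<Rightarrow> nat list \<Rightarrow> 'a mat" where
  "word_mat n A ws = foldr (\<lambda>k M. A k * M) ws (1\<^sub>m n)"

definition gen_mat :: "nat \<Rightarrow> nat \<Rightarrow> 'a::comm_ring_1 cpoly mat" where
  "gen_mat n k = mat n n (\<lambda>(i,j). cvar (k,i,j))"

definition Phi :: "nat \<Rightarrow> 'a::comm_ring_1 qpoly \<Rightarrow> 'a cpoly mat" where
  "Phi n p = mat n n (\<lambda>(i,j). \<Sum>w\<in>Poly_Mapping.keys p. Poly_Mapping.lookup p w * word_mat n (gen_mat n) (word_list w) $$ (i,j))"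

definition tr_word :: "nat \<Rightarrow> nat list \<Rightarrow> 'a::comm_ring_1 cpoly" where
  "tr_word n ws = mtrace n (word_mat n (gen_mat n) ws)"

definition ceval :: "(nat \<Rightarrow> 'a::comm_ring_1 mat) \<Rightarrow> 'a cpoly \<Rightarrow> 'a" where
  "ceval A c = (\<Sum>m\<in>Poly_Mapping.keys c. Poly_Mapping.lookup c m *
      (\<Prod>v\<in>Poly_Mapping.keys m. (case v of (k,i,j) \<Rightarrow> A k $$ (i,j)) ^ Poly_Mapping.lookup m v))"

definition qeval :: "nat \<Rightarrow> (nat \<Rightarrow> 'a::comm_ring_1 mat) \<Rightarrow> 'a qpoly \<Rightarrow> 'a mat" where
  "qeval n A p = mat n n (\<lambda>(i,j). \<Sum>w\<in>Poly_Mapping.keys p. ceval A (Poly_Mapping.lookup p w) * word_mat n A (word_list w) $$ (i,j))"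

definition quasi_identity :: "nat \<Rightarrow> 'a::comm_ring_1 qpoly \<Rightarrow> bool" where
  "quasi_identity n P \<longleftrightarrow> (\<forall>A. (\<forall>k. A k \<in> carrier_mat n n) \<longrightarrow> qeval n A P = 0\<^sub>m n n)"

definition central_poly :: "nat \<Rightarrow> 'a::comm_ring_1 qpoly \<Rightarrow> bool" where
  "central_poly n c \<longleftrightarrow> in_free_alg c \<and>
     (\<forall>A. (\<forall>k. A k \<in> carrier_mat n n) \<longrightarrow> (\<exists>a. qeval n A c = a \<cdot>\<^sub>m 1\<^sub>m n))"

definition csubst :: "nat \<Rightarrow> (nat \<Rightarrow> 'a::comm_ring_1 qpoly) \<Rightarrow> 'a cpoly \<Rightarrow> 'a cpoly" where
  "csubst n H c = (\<Sum>m\<in>Poly_Mapping.keys c. cconst (Poly_Mapping.lookup c m) *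
      (\<Prod>v\<in>Poly_Mapping.keys m. (case v of (k,i,j) \<Rightarrow> Phi n (H k) $$ (i,j)) ^ Poly_Mapping.lookup m v))"

definition qsubst :: "nat \<Rightarrow> (nat \<Rightarrow> 'a::comm_ring_1 qpoly) \<Rightarrow> 'a qpoly \<Rightarrow> 'a qpoly" where
  "qsubst n H p = (\<Sum>w\<in>Poly_Mapping.keys p. qconst (csubst n H (Poly_Mapping.lookup p w)) *
      foldr (\<lambda>k q. H k * q) (word_list w) 1)"

inductive_set T_ideal :: "nat \<Rightarrow> 'a::comm_ring_1 qpoly set \<Rightarrow> 'a qpoly set"
  for n :: nat and G :: "'a qpoly set" where
  gen: "g \<in> G \<Longrightarrow> g \<in> T_ideal n G"
| zero: "0 \<in> T_ideal n G"
| add: "p \<in> T_ideal n G \<Longrightarrow> q \<in> T_ideal n G \<Longrightarrow> p + q \<in> T_ideal n G"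
| lmult: "wf_qpoly n a \<Longrightarrow> p \<in> T_ideal n G \<Longrightarrow> a * p \<in> T_ideal n G"
| rmult: "wf_qpoly n a \<Longrightarrow> p \<in> T_ideal n G \<Longrightarrow> p * a \<in> T_ideal n G"
| subst: "(\<And>k. wf_qpoly n (H k)) \<Longrightarrow> p \<in> T_ideal n G \<Longrightarrow> qsubst n H p \<in> T_ideal n G"

text \<open>Permutations of {0..n}; the special point n plays the role of n+1, variables x_0..x_{n-1}.\<close>
definition cyc_len :: "(nat \<Rightarrow> nat) \<Rightarrow> nat \<Rightarrow> nat" where
  "cyc_len \<sigma> i = (LEAST k. 0 < k \<and> (\<sigma> ^^ k) i = i)"

definition cyc_list :: "(nat \<Rightarrow> nat) \<Rightarrow> nat \<Rightarrow> nat list" where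
  "cyc_list \<sigma> i = map (\<lambda>t. (\<sigma> ^^ t) i) [0..<cyc_len \<sigma> i]"

definition phi_perm :: "nat \<Rightarrow> (nat \<Rightarrow> nat) \<Rightarrow> 'a::comm_ring_1 qpoly" where
  "phi_perm n \<sigma> =
     qconst (\<Prod>i\<in>{i. i < n \<and> n \<notin> set (cyc_list \<sigma> i) \<and> i = Min (set (cyc_list \<sigma> i))}.
               tr_word n (cyc_list \<sigma> i))
     * Poly_Mapping.single (Word (tl (cyc_list \<sigma> n))) 1"

definition Q_CH :: "nat \<Rightarrow> 'a::comm_ring_1 qpoly" where
  "Q_CH n = (\<Sum>\<sigma>\<in>{\<sigma>. \<sigma> permutes {0..n}}. of_int (sign \<sigma>) * phi_perm n \<sigma>)"

end

theory Submission
  imports Defs "HOL-Combinatorics.Cycles" "Jordan_Normal_Form.Determinant"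
begin

text \<open>
  Let \<open>I\<close> be the T-ideal generated by \<open>Q_CH n\<close> and \<open>K\<close> the kernel of \<open>Phi n\<close>, which contains every
  quasi-identity because the base field is infinite. Elements of \<open>K\<close> have zero traces.

  Substituting \<open>k \<in> K\<close> for all variables of \<open>Q_CH n\<close> leaves only the full cycles, so \<open>k ^ n \<in> I\<close>.
  Substituting \<open>k \<in> K\<close> for one variable, and for the others lifts of orthogonal diagonal
  matrix units which annihilate \<open>k\<close> modulo \<open>I\<close>, leaves one transposition, so a multiple of \<open>k\<close> lies
  in \<open>I\<close>. Consequently, if \<open>s\<close> is a polynomial such that every matrix unit multiplied by \<open>s\<close> lies
  in the image of \<open>Phi n\<close>, then some power of \<open>s\<close> maps each given element of \<open>K\<close> into \<open>I\<close>.

  A central polynomial \<open>c\<close> without constant term has \<open>Phi n c = r \<cdot>\<^sub>m 1\<^sub>m n\<close>, and some power of \<open>r\<close> is such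
  an \<open>s\<close>: the derivatives of the homogeneous components of \<open>c\<close> are scalar operators
  \<open>y \<mapsto> \<Sum>t. U t * y * V t\<close>, and these produce enough elements in the algebra of generic matrices.
  Finally \<open>c\<close> differs from \<open>r\<close> by an element of \<open>K\<close>, which is nilpotent modulo \<open>I\<close>.
\<close>

section \<open>Substitution homomorphisms\<close>

text \<open>The obstacle is that \<open>K\<close> need not lie in \<open>I\<close>: a relation
  checked on generic matrices lifts to quasi-polynomials only up to an element of \<open>K\<close>,
  and these errors have to be controlled. An element of \<open>K\<close> is therefore cut into
  corners between lifted diagonal units. Only a diagonal corner is annihilated by the other n - 1
  diagonal units, as the transposition argument demands. An off-diagonal corner is moved to the
  diagonal and back by lifts of off-diagonal matrix units; the round trip is wrong by another
  element of \<open>K\<close>, but this error is itself a diagonal corner. Powers of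
  \<open>s\<close> accumulate because only scaled matrix units lift, and this is why a power of
  \<open>c\<close> appears in the conclusion. Characteristic 0 makes the number of full cycles
  invertible, the interpolation nodes 0, ..., n - 1 distinct, and the degree in Euler's formula
  invertible.\<close>

lemma poly_mapping_sum_single:
  fixes p :: "'k \<Rightarrow>\<^sub>0 'b::comm_monoid_add"
  shows "p = (\<Sum>k\<in>Poly_Mapping.keys p. Poly_Mapping.single k (Poly_Mapping.lookup p k))"
proof (rule poly_mapping_eqI)
  fix k
  have "(\<Sum>x\<in>Poly_Mapping.keys p. Poly_Mapping.lookup (Poly_Mapping.single x (Poly_Mapping.lookup p x)) k)
     = (\<Sum>x\<in>Poly_Mapping.keys p. if x = k then Poly_Mapping.lookup p k else 0)"
    by (rule sum.cong) (auto simp: lookup_single when_def)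
  thus "Poly_Mapping.lookup p k = Poly_Mapping.lookup
      (\<Sum>k\<in>Poly_Mapping.keys p. Poly_Mapping.single k (Poly_Mapping.lookup p k)) k"
    by (simp add: lookup_sum in_keys_iff)
qed

text \<open>The coefficient in the case \<open>single\<close> may be 0, so no separate case for the
  zero polynomial is needed. Additive statements are thereby reduced to monomials.\<close>

lemma poly_mapping_add_induct [case_names single add]:
  fixes p :: "'k \<Rightarrow>\<^sub>0 'b::comm_monoid_add"
  assumes single: "\<And>k a. Q (Poly_Mapping.single k a)"
    and add: "\<And>p q. Q p \<Longrightarrow> Q q \<Longrightarrow> Q (p + q)"
  shows "Q p"
proof -
  have "Q 0" using single[of undefined 0] by simp
  have "Q (\<Sum>k\<in>S. Poly_Mapping.single k (Poly_Mapping.lookup p k))" if "finite S" for S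
    using that \<open>Q 0\<close> by (induction S rule: finite_induct) (auto intro: single add)
  from this[OF finite_keys[of p]] show ?thesis unfolding poly_mapping_sum_single[symmetric] .
qed

text \<open>The common shape of \<open>ceval\<close>, \<open>csubst\<close>, \<open>qsubst\<close>
  and the entries of \<open>Phi\<close>, so that additivity and multiplicativity are proved once for
  all four.\<close>

definition pm_sum :: "('k \<Rightarrow> 'b \<Rightarrow> 'c) \<Rightarrow> ('k \<Rightarrow>\<^sub>0 'b::zero) \<Rightarrow> 'c::comm_monoid_add" where
  "pm_sum F p = (\<Sum>k\<in>Poly_Mapping.keys p. F k (Poly_Mapping.lookup p k))"

text \<open>Cancellation may remove keys from a sum, so sums over keys are compared only after
  enlarging them to a common index set; the value 0 at coefficient 0 permits this.\<close>

lemma pm_sum_superset: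
  assumes "finite S" "Poly_Mapping.keys p \<subseteq> S" "\<And>k. F k 0 = 0"
  shows "pm_sum F p = (\<Sum>k\<in>S. F k (Poly_Mapping.lookup p k))"
  unfolding pm_sum_def
  by (rule sum.mono_neutral_left) (use assms in \<open>auto simp: in_keys_iff\<close>)

lemma pm_sum_add:
  assumes "\<And>k. F k 0 = 0" "\<And>k a b. F k (a + b) = F k a + F k b"
  shows "pm_sum F (p + q) = pm_sum F p + pm_sum F q"
proof -
  let ?S = "Poly_Mapping.keys p \<union> Poly_Mapping.keys q"
  have "pm_sum F (p + q) = (\<Sum>k\<in>?S. F k (Poly_Mapping.lookup (p + q) k))"
    using Poly_Mapping.keys_add[of p q] by (intro pm_sum_superset) (auto simp: assms)
  also have "\<dots> = (\<Sum>k\<in>?S. F k (Poly_Mapping.lookup p k)) + (\<Sum>k\<in>?S. F k (Poly_Mapping.lookup q k))"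
    by (simp add: lookup_add assms sum.distrib)
  also have "\<dots> = pm_sum F p + pm_sum F q"
    by (subst (1 2) pm_sum_superset[of ?S]) (auto simp: assms)
  finally show ?thesis .
qed

lemma pm_sum_single:
  assumes "\<And>k. F k 0 = 0"
  shows "pm_sum F (Poly_Mapping.single k a) = F k a"
  by (cases "a = 0") (auto simp: pm_sum_def assms)

lemma pm_sum_mult:
  fixes F :: "'k::monoid_add \<Rightarrow> 'b::semiring_0 \<Rightarrow> 'c::semiring_0"
  assumes z: "\<And>k. F k 0 = 0" and a: "\<And>k a b. F k (a + b) = F k a + F k b"
    and m: "\<And>k l a b. F (k + l) (a * b) = F k a * F l b"
  shows "pm_sum F (p * q) = pm_sum F p * pm_sum F q"
proof (induction p rule: poly_mapping_add_induct)
  case (single k a)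
  show ?case
  proof (induction q rule: poly_mapping_add_induct)
    case (single l b)
    then show ?case by (simp add: mult_single pm_sum_single[of F, OF z] m)
  next
    case (add q r)
    then show ?case by (simp add: ring_distribs pm_sum_add[of F, OF z \<open>\<And>k a b. F k (a + b) = F k a + F k b\<close>])
  qed
next
  case (add p r)
  then show ?case by (simp add: ring_distribs pm_sum_add[of F, OF z \<open>\<And>k a b. F k (a + b) = F k a + F k b\<close>])
qed

definition mon_eval :: "('v \<Rightarrow> 'b::comm_semiring_1) \<Rightarrow> ('v \<Rightarrow>\<^sub>0 nat) \<Rightarrow> 'b" where
  "mon_eval t m = (\<Prod>v\<in>Poly_Mapping.keys m. t v ^ Poly_Mapping.lookup m v)"

lemma mon_eval_superset:
  assumes "finite S" "Poly_Mapping.keys m \<subseteq> S"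
  shows "mon_eval t m = (\<Prod>v\<in>S. t v ^ Poly_Mapping.lookup m v)"
  unfolding mon_eval_def
  by (rule prod.mono_neutral_left) (use assms in \<open>auto simp: in_keys_iff\<close>)

lemma mon_eval_add: "mon_eval t (m + m') = mon_eval t m * mon_eval t m'"
proof -
  let ?S = "Poly_Mapping.keys m \<union> Poly_Mapping.keys m'"
  have "mon_eval t (m + m') = (\<Prod>v\<in>?S. t v ^ Poly_Mapping.lookup (m + m') v)"
    using Poly_Mapping.keys_add[of m m'] by (intro mon_eval_superset) auto
  also have "\<dots> = (\<Prod>v\<in>?S. t v ^ Poly_Mapping.lookup m v) * (\<Prod>v\<in>?S. t v ^ Poly_Mapping.lookup m' v)"
    by (simp add: lookup_add power_add prod.distrib)
  also have "\<dots> = mon_eval t m * mon_eval t m'"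
    by (subst (1 2) mon_eval_superset[of ?S]) auto
  finally show ?thesis .
qed

lemma mon_eval_zero [simp]: "mon_eval t 0 = 1"
  by (simp add: mon_eval_def)

lemma mon_eval_single [simp]: "mon_eval t (Poly_Mapping.single v (Suc 0)) = t v"
  by (simp add: mon_eval_def)

lemma comm_ring_hom_pm_sum:
  fixes \<iota> :: "'a::comm_ring_1 \<Rightarrow> 'b::comm_ring_1" and t :: "'v \<Rightarrow> 'b"
  assumes "comm_ring_hom \<iota>"
  shows "comm_ring_hom (pm_sum (\<lambda>m a. \<iota> a * mon_eval t m))"
proof -
  interpret comm_ring_hom \<iota> by fact
  let ?F = "\<lambda>m a. \<iota> a * mon_eval t m"
  show ?thesis
  proof
    show "pm_sum ?F 0 = 0" by (simp add: pm_sum_def)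
    show "pm_sum ?F 1 = 1" by (simp add: pm_sum_def)
    show "pm_sum ?F (x + y) = pm_sum ?F x + pm_sum ?F y" for x y
      by (rule pm_sum_add) (simp_all add: hom_add ring_distribs)
    show "pm_sum ?F (x * y) = pm_sum ?F x * pm_sum ?F y" for x y
      by (rule pm_sum_mult) (simp_all add: hom_add hom_mult ring_distribs mon_eval_add ac_simps)
  qed
qed

lemma comm_ring_hom_cconst: "comm_ring_hom (cconst :: 'a::comm_ring_1 \<Rightarrow> 'a cpoly)"
  by unfold_locales (auto simp: cconst_def single_add mult_single)

interpretation cconst: comm_ring_hom "cconst :: 'a::comm_ring_1 \<Rightarrow> 'a cpoly"
  by (rule comm_ring_hom_cconst)

lemma ceval_pm_sum:
  "ceval A = pm_sum (\<lambda>m a. a * mon_eval (\<lambda>v. case v of (k,i,j) \<Rightarrow> A k $$ (i,j)) m)"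
  by (auto simp: fun_eq_iff ceval_def pm_sum_def mon_eval_def)

lemma csubst_pm_sum:
  "csubst n H = pm_sum (\<lambda>m a. cconst a * mon_eval (\<lambda>v. case v of (k,i,j) \<Rightarrow> Phi n (H k) $$ (i,j)) m)"
  by (auto simp: fun_eq_iff csubst_def pm_sum_def mon_eval_def)

interpretation ceval: comm_ring_hom "ceval A" for A :: "nat \<Rightarrow> 'a::comm_ring_1 mat"
  unfolding ceval_pm_sum by (rule comm_ring_hom_pm_sum[of "\<lambda>x. x"], unfold_locales) auto

interpretation csubst: comm_ring_hom "csubst n H" for n and H :: "nat \<Rightarrow> 'a::comm_ring_1 qpoly"
  unfolding csubst_pm_sum by (rule comm_ring_hom_pm_sum[OF comm_ring_hom_cconst])

lemma ceval_cvar: "ceval A (cvar (k,i,j)) = A k $$ (i,j)"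
  by (simp add: ceval_pm_sum pm_sum_single cvar_def)

lemma ceval_cconst [simp]: "ceval A (cconst a) = a"
  by (simp add: ceval_pm_sum pm_sum_single cconst_def)

lemma csubst_cvar: "csubst n H (cvar (k,i,j)) = Phi n (H k) $$ (i,j)"
  by (simp add: csubst_pm_sum pm_sum_single cvar_def)

interpretation qconst: ring_hom "qconst :: 'a::comm_ring_1 cpoly \<Rightarrow> 'a qpoly"
  by unfold_locales (auto simp: qconst_def single_add mult_single)

lemma qconst_commute: "p * qconst c = qconst c * p" for p :: "'a::comm_ring_1 qpoly"
proof (induction p rule: poly_mapping_add_induct)
  case (single k a)
  show ?case by (simp add: qconst_def mult_single mult.commute)
next
  case (add p q)
  thus ?case by (simp add: ring_distribs)
qed

lemma qconst_left_commute: "p * (qconst c * q) = qconst c * (p * q)" for p :: "'a::comm_ring_1 qpoly"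
  by (simp only: mult.assoc[symmetric] qconst_commute[of p])

lemma qconst_mult_mult: "(qconst a * p) * (qconst b * q) = qconst (a * b) * (p * q)"
  for p :: "'a::comm_ring_1 qpoly"
  by (simp only: qconst.hom_mult mult.assoc qconst_left_commute[of p])

lemma word_mat_Nil [simp]: "word_mat n A [] = 1\<^sub>m n"
  and word_mat_Cons [simp]: "word_mat n A (k # ws) = A k * word_mat n A ws"
  by (simp_all add: word_mat_def)

section \<open>Products of matrices along words, and the homomorphism to generic matrices\<close>

lemma word_mat_carrier [simp, intro]:
  "(\<And>k. A k \<in> carrier_mat n n) \<Longrightarrow> word_mat n A ws \<in> carrier_mat n n"
  by (induction ws) (auto intro: mult_carrier_mat[of _ n n _ n])

lemma word_mat_dim [simp]:
  assumes "\<And>k. A k \<in> carrier_mat n n"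
  shows "dim_row (word_mat n A ws) = n" "dim_col (word_mat n A ws) = n"
  using word_mat_carrier[of A n ws, OF assms] by auto

lemma word_mat_append:
  assumes "\<And>k. A k \<in> carrier_mat n n"
  shows "word_mat n A (us @ vs) = word_mat n A us * word_mat n A vs"
proof (induction us)
  case Nil
  show ?case using left_mult_one_mat[OF word_mat_carrier[of A n vs, OF assms]] by simp
next
  case (Cons k us)
  have "A k * (word_mat n A us * word_mat n A vs) = A k * word_mat n A us * word_mat n A vs"
    by (rule assoc_mult_mat[symmetric, OF assms word_mat_carrier[OF assms] word_mat_carrier[OF assms]])
  with Cons show ?case by simp
qed

lemma gen_mat_carrier [simp, intro]: "gen_mat n k \<in> carrier_mat n n"
  by (simp add: gen_mat_def)

lemma (in comm_ring_hom) word_mat_hom: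
  assumes "\<And>k. A k \<in> carrier_mat n n"
  shows "map_mat hom (word_mat n A ws) = word_mat n (\<lambda>k. map_mat hom (A k)) ws"
proof (induction ws)
  case Nil
  show ?case by (simp add: mat_hom_one)
next
  case (Cons k ws)
  show ?case
    using Cons mat_hom_mult[OF assms[of k] word_mat_carrier[of A n ws]] assms by simp
qed

lemma Phi_carrier [simp, intro]: "Phi n p \<in> carrier_mat n n"
  by (simp add: Phi_def)

lemma Phi_dim [simp]: "dim_row (Phi n p) = n" "dim_col (Phi n p) = n"
  by (simp_all add: Phi_def)

lemma Phi_entry:
  assumes "i < n" "j < n"
  shows "Phi n p $$ (i,j) = pm_sum (\<lambda>w a. a * word_mat n (gen_mat n) (word_list w) $$ (i,j)) p"
  using assms by (simp add: Phi_def pm_sum_def)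

lemma Phi_zero [simp]: "Phi n 0 = 0\<^sub>m n n"
  by (rule eq_matI) (auto simp: Phi_entry pm_sum_def)

lemma Phi_add: "Phi n (p + q) = Phi n p + Phi n q"
  by (rule eq_matI) (auto simp: Phi_entry pm_sum_add ring_distribs)

lemma Phi_single: "Phi n (Poly_Mapping.single w a) = a \<cdot>\<^sub>m word_mat n (gen_mat n) (word_list w)"
  by (intro eq_matI) (auto simp: Phi_entry pm_sum_single)

lemma Phi_qconst: "Phi n (qconst a) = a \<cdot>\<^sub>m 1\<^sub>m n"
  by (simp add: qconst_def Phi_single zero_word_def)

lemma Phi_one [simp]: "Phi n (1 :: 'a::comm_ring_1 qpoly) = 1\<^sub>m n"
proof -
  have "Phi n (qconst 1 :: 'a::comm_ring_1 qpoly) = 1\<^sub>m n" unfolding Phi_qconst by auto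
  thus ?thesis by simp
qed

lemma Phi_mult: "Phi n (p * q) = Phi n p * Phi n q"
proof (induction p rule: poly_mapping_add_induct)
  case (single u a)
  show ?case
  proof (induction q rule: poly_mapping_add_induct)
    case (single v b)
    let ?W = "\<lambda>w. word_mat n (gen_mat n) (word_list w) :: 'a cpoly mat"
    have c: "?W u \<in> carrier_mat n n" "?W v \<in> carrier_mat n n" by auto
    have "?W (u + v) = ?W u * ?W v"
      by (simp add: plus_word_def word_mat_append)
    moreover have "(a \<cdot>\<^sub>m ?W u) * (b \<cdot>\<^sub>m ?W v) = (a * b) \<cdot>\<^sub>m (?W u * ?W v)"
      by (subst mult_smult_distrib[OF smult_carrier_mat[OF c(1)] c(2)], subst mult_smult_assoc_mat[OF c])
        (auto simp: ac_simps)
    ultimately show ?case by (simp add: mult_single Phi_single)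
  next
    case (add q r)
    then show ?case
      by (simp add: ring_distribs Phi_add mult_add_distrib_mat[of _ n n _ n])
  qed
next
  case (add p r)
  then show ?case
    by (simp add: ring_distribs Phi_add add_mult_distrib_mat[of _ n n _ _ n])
qed

lemma Phi_qconst_mult: "Phi n (qconst a * p) = a \<cdot>\<^sub>m Phi n p"
  by (simp add: Phi_mult Phi_qconst mult_smult_assoc_mat[of _ n n _ n])

lemma Phi_uminus: "Phi n (- p) = - Phi n p"
proof -
  have "- p = qconst (-1) * p" by (simp add: qconst.hom_uminus)
  hence "Phi n (- p) = (-1) \<cdot>\<^sub>m Phi n p" by (simp only: Phi_qconst_mult)
  thus ?thesis by auto
qed

lemma Phi_minus: "Phi n (p - q) = Phi n p - Phi n q"
  using Phi_add[of n p "- q"] minus_add_uminus_mat[of "Phi n p" n n "Phi n q"] by (simp add: Phi_uminus)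

lemma Phi_sum_entry:
  assumes "i < n" "j < n"
  shows "Phi n (\<Sum>x\<in>X. f x) $$ (i,j) = (\<Sum>x\<in>X. Phi n (f x) $$ (i,j))"
  by (induction X rule: infinite_finite_induct) (use assms in \<open>auto simp: Phi_add\<close>)

section \<open>Simultaneous substitutions in quasi-polynomials\<close>

definition list_prod :: "(nat \<Rightarrow> 'b::monoid_mult) \<Rightarrow> nat list \<Rightarrow> 'b" where
  "list_prod H ws = foldr (\<lambda>k q. H k * q) ws 1"

lemma list_prod_simps [simp]: "list_prod H [] = 1" "list_prod H (k # ws) = H k * list_prod H ws"
  by (simp_all add: list_prod_def)

lemma list_prod_append: "list_prod H (us @ vs) = list_prod H us * list_prod H vs"
  by (induction us) (simp_all add: mult.assoc)

lemma qsubst_pm_sum: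
  "qsubst n H = pm_sum (\<lambda>w a. qconst (csubst n H a) * list_prod H (word_list w))"
  by (auto simp: fun_eq_iff qsubst_def pm_sum_def list_prod_def)

interpretation qsubst: ring_hom "qsubst n H" for n and H :: "nat \<Rightarrow> 'a::comm_ring_1 qpoly"
proof
  let ?F = "\<lambda>w a. qconst (csubst n H a) * list_prod H (word_list w)"
  show "qsubst n H 0 = 0" by (simp add: qsubst_pm_sum pm_sum_def)
  show "qsubst n H 1 = 1" by (simp add: qsubst_pm_sum pm_sum_def zero_word_def[symmetric])
      (simp add: zero_word_def)
  show "qsubst n H (x + y) = qsubst n H x + qsubst n H y" for x y
    unfolding qsubst_pm_sum by (rule pm_sum_add) (auto simp: csubst.hom_add qconst.hom_add ring_distribs)
  show "qsubst n H (x * y) = qsubst n H x * qsubst n H y" for x y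
    unfolding qsubst_pm_sum
  proof (rule pm_sum_mult)
    fix k l a b
    show "?F (k + l) (a * b) = ?F k a * ?F l b"
      by (simp add: csubst.hom_mult plus_word_def list_prod_append qconst_mult_mult)
  qed (auto simp: csubst.hom_add qconst.hom_add ring_distribs)
qed

lemma csubst_tr_word:
  "csubst n H (tr_word n ws) = mtrace n (word_mat n (\<lambda>k. Phi n (H k)) ws)"
proof -
  have "map_mat (csubst n H) (gen_mat n k) = Phi n (H k)" for k
    by (rule eq_matI) (auto simp: gen_mat_def csubst_cvar)
  hence *: "map_mat (csubst n H) (word_mat n (gen_mat n) ws) = word_mat n (\<lambda>k. Phi n (H k)) ws"
    using csubst.word_mat_hom[of "gen_mat n" n n H ws] by simp
  show ?thesis
    by (auto simp: tr_word_def mtrace_def csubst.hom_sum *[symmetric])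
qed

text \<open>The trace factors see only the matrices \<open>Phi n (H k)\<close>, whereas the cycle
  through \<open>n\<close> becomes a product of the \<open>H k\<close> themselves. An element of the
  kernel of \<open>Phi n\<close> thus kills a term when it sits under a trace but survives outside
  of the traces.\<close>

lemma qsubst_phi_perm:
  "qsubst n H (phi_perm n \<sigma>) =
     qconst (\<Prod>i\<in>{i. i < n \<and> n \<notin> set (cyc_list \<sigma> i) \<and> i = Min (set (cyc_list \<sigma> i))}.
               mtrace n (word_mat n (\<lambda>k. Phi n (H k)) (cyc_list \<sigma> i)))
     * list_prod H (tl (cyc_list \<sigma> n))"
proof -
  have "qsubst n H (qconst c) = qconst (csubst n H c)" for c
    by (simp add: qsubst_pm_sum qconst_def pm_sum_single zero_word_def)
  moreover have "qsubst n H (Poly_Mapping.single (Word ws) 1) = list_prod H ws" for ws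
    by (simp add: qsubst_pm_sum pm_sum_single)
  ultimately show ?thesis
    by (simp add: phi_perm_def qsubst.hom_mult csubst.hom_prod csubst_tr_word)
qed

section \<open>Polynomials in the entries of n by n matrices\<close>

text \<open>The type also contains variables whose matrix indices are out of range. This predicate
  carves out the coefficient ring of the theorem; \<open>T_ideal\<close> admits only multipliers and
  substitutions over it.\<close>

definition wf_cpoly :: "nat \<Rightarrow> 'a::zero cpoly \<Rightarrow> bool" where
  "wf_cpoly n c \<longleftrightarrow> (\<forall>mo\<in>Poly_Mapping.keys c. \<forall>v\<in>Poly_Mapping.keys mo. fst (snd v) < n \<and> snd (snd v) < n)"

lemma wf_qpoly_iff: "wf_qpoly n p \<longleftrightarrow> (\<forall>w. wf_cpoly n (Poly_Mapping.lookup p w))"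
proof -
  have "wf_cpoly n (Poly_Mapping.lookup p w)" if "w \<notin> Poly_Mapping.keys p" for w
    using that by (simp add: in_keys_iff wf_cpoly_def)
  thus ?thesis unfolding wf_qpoly_def wf_cpoly_def by blast
qed

lemma wf_cpoly_0 [simp]: "wf_cpoly n 0"
  and wf_cpoly_1 [simp]: "wf_cpoly n (1 :: 'a::zero_neq_one cpoly)"
  and wf_cpoly_cconst [simp]: "wf_cpoly n (cconst a)"
  and wf_cpoly_cvar: "i < n \<Longrightarrow> j < n \<Longrightarrow> wf_cpoly n (cvar (k,i,j) :: 'a cpoly)"
  by (auto simp: wf_cpoly_def cconst_def cvar_def)

lemma wf_cpoly_add: "wf_cpoly n a \<Longrightarrow> wf_cpoly n b \<Longrightarrow> wf_cpoly n (a + b)"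
  for a b :: "'a::comm_ring_1 cpoly"
  using Poly_Mapping.keys_add[of a b] unfolding wf_cpoly_def by blast

lemma wf_cpoly_uminus: "wf_cpoly n a \<Longrightarrow> wf_cpoly n (- a)"
  for a :: "'a::comm_ring_1 cpoly"
  unfolding wf_cpoly_def by (simp add: in_keys_iff)

lemma wf_cpoly_minus: "wf_cpoly n a \<Longrightarrow> wf_cpoly n b \<Longrightarrow> wf_cpoly n (a - b)"
  for a b :: "'a::comm_ring_1 cpoly"
  using wf_cpoly_add[of n a "- b"] by (simp add: wf_cpoly_uminus)

lemma wf_cpoly_mult: "wf_cpoly n a \<Longrightarrow> wf_cpoly n b \<Longrightarrow> wf_cpoly n (a * b)"
  for a b :: "'a::comm_ring_1 cpoly"
  unfolding wf_cpoly_def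
proof (intro ballI)
  fix mo v
  assume a: "\<forall>mo\<in>Poly_Mapping.keys a. \<forall>v\<in>Poly_Mapping.keys mo. fst (snd v) < n \<and> snd (snd v) < n"
    and b: "\<forall>mo\<in>Poly_Mapping.keys b. \<forall>v\<in>Poly_Mapping.keys mo. fst (snd v) < n \<and> snd (snd v) < n"
    and mo: "mo \<in> Poly_Mapping.keys (a * b)" and v: "v \<in> Poly_Mapping.keys mo"
  obtain m1 m2 where "m1 \<in> Poly_Mapping.keys a" "m2 \<in> Poly_Mapping.keys b" "mo = m1 + m2"
    using mo keys_mult[of a b] by blast
  thus "fst (snd v) < n \<and> snd (snd v) < n"
    using v a b Poly_Mapping.keys_add[of m1 m2] by blast
qed

lemma wf_cpoly_sum: "(\<And>x. x \<in> X \<Longrightarrow> wf_cpoly n (f x)) \<Longrightarrow> wf_cpoly n (\<Sum>x\<in>X. f x)"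
  for f :: "'b \<Rightarrow> 'a::comm_ring_1 cpoly"
  by (induction X rule: infinite_finite_induct) (auto intro: wf_cpoly_add)

lemma wf_cpoly_prod: "(\<And>x. x \<in> X \<Longrightarrow> wf_cpoly n (f x)) \<Longrightarrow> wf_cpoly n (\<Prod>x\<in>X. f x)"
  for f :: "'b \<Rightarrow> 'a::comm_ring_1 cpoly"
  by (induction X rule: infinite_finite_induct) (auto intro: wf_cpoly_mult)

lemma wf_cpoly_power: "wf_cpoly n a \<Longrightarrow> wf_cpoly n (a ^ m)"
  for a :: "'a::comm_ring_1 cpoly"
  by (induction m) (auto intro: wf_cpoly_mult)

lemma wf_cpoly_of_nat: "wf_cpoly n (of_nat m :: 'a::comm_ring_1 cpoly)"
  by (induction m) (auto intro: wf_cpoly_add)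

lemma wf_qpoly_0 [simp]: "wf_qpoly n 0"
  by (simp add: wf_qpoly_iff)

lemma wf_qpoly_add: "wf_qpoly n p \<Longrightarrow> wf_qpoly n q \<Longrightarrow> wf_qpoly n (p + q)"
  for p q :: "'a::comm_ring_1 qpoly"
  by (simp add: wf_qpoly_iff lookup_add wf_cpoly_add)

lemma wf_qpoly_uminus: "wf_qpoly n p \<Longrightarrow> wf_qpoly n (- p)"
  for p :: "'a::comm_ring_1 qpoly"
  by (simp add: wf_qpoly_iff wf_cpoly_uminus)

lemma wf_qpoly_minus: "wf_qpoly n p \<Longrightarrow> wf_qpoly n q \<Longrightarrow> wf_qpoly n (p - q)"
  for p q :: "'a::comm_ring_1 qpoly"
  by (simp add: wf_qpoly_iff lookup_minus wf_cpoly_minus)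

lemma wf_qpoly_sum: "(\<And>x. x \<in> X \<Longrightarrow> wf_qpoly n (f x)) \<Longrightarrow> wf_qpoly n (\<Sum>x\<in>X. f x)"
  for f :: "'b \<Rightarrow> 'a::comm_ring_1 qpoly"
  by (induction X rule: infinite_finite_induct) (auto intro: wf_qpoly_add)

lemma wf_qpoly_single: "wf_qpoly n (Poly_Mapping.single w a) \<longleftrightarrow> wf_cpoly n a"
  by (auto simp: wf_qpoly_iff lookup_single when_def)

lemma wf_qpoly_qconst [simp]: "wf_qpoly n (qconst a) \<longleftrightarrow> wf_cpoly n a"
  by (simp add: qconst_def wf_qpoly_single)

lemma wf_qpoly_1 [simp]: "wf_qpoly n (1 :: 'a::comm_ring_1 qpoly)"
  using wf_qpoly_qconst[of n "1 :: 'a cpoly"] by simp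

lemma wf_qpoly_mult: "wf_qpoly n p \<Longrightarrow> wf_qpoly n q \<Longrightarrow> wf_qpoly n (p * q)"
  for p q :: "'a::comm_ring_1 qpoly"
  unfolding wf_qpoly_iff[of n p] wf_qpoly_iff[of n q]
  by (subst poly_mapping_sum_single[of p], subst poly_mapping_sum_single[of q])
    (auto simp: sum_product mult_single wf_qpoly_single intro!: wf_qpoly_sum wf_cpoly_mult)

lemma wf_qpoly_power: "wf_qpoly n p \<Longrightarrow> wf_qpoly n (p ^ m)"
  for p :: "'a::comm_ring_1 qpoly"
  by (induction m) (auto intro: wf_qpoly_mult)

lemmas wf_intros = wf_cpoly_add wf_cpoly_uminus wf_cpoly_minus wf_cpoly_mult wf_cpoly_sum
  wf_cpoly_prod wf_cpoly_power wf_cpoly_of_nat wf_qpoly_add wf_qpoly_uminus wf_qpoly_minus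
  wf_qpoly_sum wf_qpoly_mult wf_qpoly_power

lemma wf_word_mat_gen:
  "i < n \<Longrightarrow> j < n \<Longrightarrow> wf_cpoly n (word_mat n (gen_mat n) ws $$ (i,j) :: 'a::comm_ring_1 cpoly)"
proof (induction ws arbitrary: i)
  case (Cons k ws)
  have "word_mat n (gen_mat n) (k # ws) $$ (i,j) =
      (\<Sum>l<n. cvar (k,i,l) * word_mat n (gen_mat n) ws $$ (l,j) :: 'a cpoly)"
    using Cons.prems word_mat_dim[of "gen_mat n" n ws]
    by (auto simp: gen_mat_def scalar_prod_def lessThan_atLeast0 intro!: sum.cong)
  thus ?case using Cons by (auto intro!: wf_cpoly_sum wf_cpoly_mult wf_cpoly_cvar)
qed auto

lemma wf_Phi: "wf_qpoly n p \<Longrightarrow> i < n \<Longrightarrow> j < n \<Longrightarrow> wf_cpoly n (Phi n p $$ (i,j))"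
  for p :: "'a::comm_ring_1 qpoly"
  by (auto simp: Phi_entry pm_sum_def wf_qpoly_iff intro!: wf_cpoly_sum wf_cpoly_mult wf_word_mat_gen)

lemma wf_word_mat_Phi:
  fixes H :: "nat \<Rightarrow> 'a::comm_ring_1 qpoly"
  assumes wf: "\<And>k. wf_qpoly n (H k)"
  shows "i < n \<Longrightarrow> j < n \<Longrightarrow> wf_cpoly n (word_mat n (\<lambda>k. Phi n (H k)) ws $$ (i,j))"
proof (induction ws arbitrary: i)
  case (Cons k ws)
  have "word_mat n (\<lambda>k. Phi n (H k)) (k # ws) $$ (i,j) =
      (\<Sum>l<n. Phi n (H k) $$ (i,l) * word_mat n (\<lambda>k. Phi n (H k)) ws $$ (l,j))"
    using Cons.prems word_mat_dim[of "\<lambda>k. Phi n (H k)" n ws]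
    by (auto simp: scalar_prod_def lessThan_atLeast0 intro!: sum.cong)
  thus ?case using Cons by (auto intro!: wf_cpoly_sum wf_cpoly_mult wf_Phi wf)
qed auto

section \<open>The ideal generated by the Cayley--Hamilton polynomial\<close>

abbreviation (input) CH_ideal :: "nat \<Rightarrow> 'a::comm_ring_1 qpoly set" where
  "CH_ideal n \<equiv> T_ideal n {Q_CH n}"

lemma T_ideal_uminus: "p \<in> T_ideal n G \<Longrightarrow> - p \<in> T_ideal n G"
  using T_ideal.lmult[of n "-1" p G] by (simp add: wf_qpoly_uminus)

lemma T_ideal_minus: "p \<in> T_ideal n G \<Longrightarrow> q \<in> T_ideal n G \<Longrightarrow> p - q \<in> T_ideal n G"
  using T_ideal.add[of p n G "- q"] by (simp add: T_ideal_uminus)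

lemma T_ideal_sum: "(\<And>x. x \<in> X \<Longrightarrow> f x \<in> T_ideal n G) \<Longrightarrow> (\<Sum>x\<in>X. f x) \<in> T_ideal n G"
  by (induction X rule: infinite_finite_induct) (auto intro: T_ideal.zero T_ideal.add)

lemma wf_qpoly_of_int: "wf_qpoly n (of_int z :: 'a::comm_ring_1 qpoly)"
proof -
  have "(of_int z :: 'a qpoly) = qconst (cconst (of_int z))"
    by (simp only: cconst.hom_of_int qconst.hom_of_int)
  thus ?thesis by (simp only: wf_qpoly_qconst wf_cpoly_cconst)
qed

lemma Q_CH_subst_mem:
  fixes H :: "nat \<Rightarrow> 'a::comm_ring_1 qpoly"
  assumes "\<And>k. wf_qpoly n (H k)"
  shows "(\<Sum>\<sigma>\<in>{\<sigma>. \<sigma> permutes {0..n}}. of_int (sign \<sigma>) * qsubst n H (phi_perm n \<sigma>)) \<in> CH_ideal n"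
proof -
  have "qsubst n H (Q_CH n) \<in> CH_ideal n"
    using assms by (intro T_ideal.subst T_ideal.gen) auto
  thus ?thesis
    by (simp add: Q_CH_def qsubst.hom_sum qsubst.hom_mult qsubst.hom_of_int)
qed

section \<open>Cycles of permutations of {0..n}\<close>

lemma cyc_list_support: "cyc_list \<sigma> i = support \<sigma> i"
  by (simp add: cyc_list_def cyc_len_def least_power_def conj_commute)

context
  fixes \<sigma> :: "nat \<Rightarrow> nat" and n :: nat
  assumes perm: "\<sigma> permutes {0..n}"
begin

lemma cyc_permutation: "permutation \<sigma>"
  using perm permutes_imp_permutation by blast

lemma cyc_set: "set (cyc_list \<sigma> i) = range (\<lambda>t. (\<sigma> ^^ t) i)"
  unfolding cyc_list_support by (rule support_set[OF cyc_permutation])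

lemma cyc_distinct: "distinct (cyc_list \<sigma> i)"
  unfolding cyc_list_support by (rule cycle_of_permutation[OF cyc_permutation])

lemma cyc_self: "i \<in> set (cyc_list \<sigma> i)"
  unfolding cyc_set using rangeI[of "\<lambda>t. (\<sigma> ^^ t) i" 0] by simp

lemma cyc_step: "\<sigma> i \<in> set (cyc_list \<sigma> i)"
  unfolding cyc_set using rangeI[of "\<lambda>t. (\<sigma> ^^ t) i" 1] by simp

lemma cyc_eq: "x \<in> set (cyc_list \<sigma> i) \<Longrightarrow> set (cyc_list \<sigma> x) = set (cyc_list \<sigma> i)"
proof -
  assume "x \<in> set (cyc_list \<sigma> i)"
  hence "set (cyc_list \<sigma> x) \<inter> set (cyc_list \<sigma> i) \<noteq> {}" using cyc_self[of x] by blast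
  thus ?thesis
    using disjointD[OF disjoint_support[OF cyc_permutation], of "set (support \<sigma> x)" "set (support \<sigma> i)"]
    unfolding cyc_list_support by blast
qed

lemma cyc_subset: "i \<le> n \<Longrightarrow> set (cyc_list \<sigma> i) \<subseteq> {0..n}"
  unfolding cyc_set using permutes_in_image[OF permutes_funpow[OF perm]] by auto

lemma cyc_Cons: "cyc_list \<sigma> i = i # tl (cyc_list \<sigma> i)"
proof -
  have "least_power \<sigma> i > 0" using least_power_of_permutation(2)[OF cyc_permutation] .
  then obtain m where "least_power \<sigma> i = Suc m" by (cases "least_power \<sigma> i") auto
  thus ?thesis unfolding cyc_list_support by (simp add: upt_conv_Cons del: upt_Suc)
qed

text \<open>Trace factors are indexed by the least element of each cycle avoiding \<open>n\<close>.
  A cycle reached at another point is transferred to its minimum; its list may then start elsewhere,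
  but its set is the same.\<close>

lemma Min_cyc_mem:
  assumes "i \<le> n" "n \<notin> set (cyc_list \<sigma> i)"
  shows "Min (set (cyc_list \<sigma> i)) \<in> {i. i < n \<and> n \<notin> set (cyc_list \<sigma> i) \<and> i = Min (set (cyc_list \<sigma> i))}"
    and "set (cyc_list \<sigma> (Min (set (cyc_list \<sigma> i)))) = set (cyc_list \<sigma> i)"
proof -
  let ?m = "Min (set (cyc_list \<sigma> i))"
  have m: "?m \<in> set (cyc_list \<sigma> i)" using cyc_self[of i] by (intro Min_in) auto
  thus e: "set (cyc_list \<sigma> ?m) = set (cyc_list \<sigma> i)" by (rule cyc_eq)
  have "?m \<le> n" "?m \<noteq> n" using m cyc_subset[OF assms(1)] assms(2) by auto
  thus "?m \<in> {i. i < n \<and> n \<notin> set (cyc_list \<sigma> i) \<and> i = Min (set (cyc_list \<sigma> i))}"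
    using e assms by (simp only: mem_Collect_eq) simp
qed

text \<open>A cycle avoiding \<open>n\<close> would contribute its minimum to the index set, so the
  absence of trace factors means that all points lie in the cycle of \<open>n\<close>.\<close>

lemma full_cycle_iff:
  "{i. i < n \<and> n \<notin> set (cyc_list \<sigma> i) \<and> i = Min (set (cyc_list \<sigma> i))} = {}
     \<longleftrightarrow> set (cyc_list \<sigma> n) = {0..n}" (is "?S = {} \<longleftrightarrow> _")
proof
  assume S: "?S = {}"
  have "i \<in> set (cyc_list \<sigma> n)" if "i \<le> n" for i
  proof -
    have "n \<in> set (cyc_list \<sigma> i)" using Min_cyc_mem(1)[OF that] S by blast
    from cyc_eq[OF this] show ?thesis using cyc_self[of i] by blast
  qed
  thus "set (cyc_list \<sigma> n) = {0..n}" using cyc_subset[of n] by auto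
next
  assume "set (cyc_list \<sigma> n) = {0..n}"
  hence "n \<in> set (cyc_list \<sigma> i)" if "i < n" for i
    using cyc_eq[of i n] cyc_self[of n] that by auto
  thus "?S = {}" by blast
qed

lemma full_cycle_length:
  assumes "set (cyc_list \<sigma> n) = {0..n}"
  shows "length (cyc_list \<sigma> n) = Suc n"
  using distinct_card[OF cyc_distinct[of n]] assms by simp

end

lemma sign_cycle_of_list: "distinct cs \<Longrightarrow> sign (cycle_of_list cs) = (-1) ^ (length cs - 1)"
proof (induction cs rule: cycle_of_list.induct)
  case (1 i j cs)
  have "sign (transpose i j \<circ> cycle_of_list (j # cs)) = sign (transpose i j) * sign (cycle_of_list (j # cs))"
    by (rule sign_compose) (auto intro: permutation_swap_id permutation_of_cycle)
  with 1 show ?case by (simp add: sign_swap_id del: comp_apply)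
qed (auto simp: sign_id)

text \<open>All full cycles have the same sign, so their contributions to the Cayley--Hamilton
  polynomial cannot cancel each other.\<close>

lemma sign_full_cycle:
  assumes "\<sigma> permutes {0..n}" "set (cyc_list \<sigma> n) = {0..n}"
  shows "sign \<sigma> = (-1) ^ n"
proof -
  have "\<sigma> x = cycle_of_list (cyc_list \<sigma> n) x" for x
  proof (cases "x \<le> n")
    case True
    thus ?thesis
      using cycle_restrict[OF cyc_permutation[OF assms(1)], of x n] assms(2)
      by (simp add: cyc_list_support)
  next
    case False
    thus ?thesis using assms permutes_not_in[OF assms(1), of x] id_outside_supp[of x "cyc_list \<sigma> n"] by simp
  qed
  hence "\<sigma> = cycle_of_list (cyc_list \<sigma> n)" by (rule ext)
  hence "sign \<sigma> = sign (cycle_of_list (cyc_list \<sigma> n))" by (rule arg_cong)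
  also have "\<dots> = (-1) ^ n"
    using sign_cycle_of_list[OF cyc_distinct[OF assms(1), of n]] full_cycle_length[OF assms]
    by simp
  finally show ?thesis .
qed

lemma full_cycle_exists: "\<exists>\<sigma>. \<sigma> permutes {0..n} \<and> set (cyc_list \<sigma> n) = {0..n}"
proof -
  let ?cs = "[0..<Suc n]"
  let ?\<sigma> = "cycle_of_list ?cs"
  have p: "?\<sigma> permutes {0..n}"
    using cycle_permutes[of ?cs] by (simp add: atLeastLessThanSuc_atLeastAtMost del: upt_Suc)
  have "(?\<sigma> ^^ t) 0 = t" if "t \<le> n" for t
  proof -
    have "map (?\<sigma> ^^ t) ?cs ! 0 = rotate t ?cs ! 0"
      by (subst cyclic_rotation) (auto simp del: upt_Suc)
    also have "\<dots> = t" using that by (subst nth_rotate) (auto simp del: upt_Suc)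
    finally show ?thesis by (simp del: upt_Suc)
  qed
  hence "t \<in> set (cyc_list ?\<sigma> 0)" if "t \<le> n" for t
    unfolding cyc_set[OF p] using that by (metis rangeI)
  hence s: "set (cyc_list ?\<sigma> 0) = {0..n}" using cyc_subset[OF p, of 0] by auto
  hence "set (cyc_list ?\<sigma> n) = {0..n}" using cyc_eq[OF p, of n 0] by simp
  with p show ?thesis by blast
qed

section \<open>Substituting elements of the kernel of \<open>Phi\<close> into the Cayley--Hamilton
  polynomial\<close>

lemma word_mat_eq_0:
  assumes "\<And>k. A k \<in> carrier_mat n n" "l \<in> set ws" "A l = 0\<^sub>m n n"
  shows "word_mat n A ws = 0\<^sub>m n n"
  using assms(2)
proof (induction ws)
  case (Cons k ws)
  show ?case
  proof (cases "k = l")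
    case True
    thus ?thesis using assms(3) left_mult_zero_mat[OF word_mat_carrier[OF assms(1)]] by simp
  next
    case False
    thus ?thesis using Cons right_mult_zero_mat[OF assms(1)[of k]] by simp
  qed
qed simp

lemma mtrace_zero [simp]: "mtrace n (0\<^sub>m n n) = 0"
  by (simp add: mtrace_def)

theorem ker_Phi_nil:
  fixes k :: "'a::field_char_0 qpoly"
  assumes wf: "wf_qpoly n k" and 0: "Phi n k = 0\<^sub>m n n"
  shows "k ^ n \<in> CH_ideal n"
proof -
  let ?H = "\<lambda>_. k"
  define Full where "Full = {\<sigma>. \<sigma> permutes {0..n} \<and> set (cyc_list \<sigma> n) = {0..n}}"
  have lp: "list_prod ?H ws = k ^ length ws" for ws
    by (induction ws) auto
  have full: "qsubst n ?H (phi_perm n \<sigma>) = k ^ n" if "\<sigma> \<in> Full" for \<sigma>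
  proof -
    have s: "\<sigma> permutes {0..n}" "set (cyc_list \<sigma> n) = {0..n}" using that by (auto simp: Full_def)
    show ?thesis
      unfolding qsubst_phi_perm full_cycle_iff[OF s(1), THEN iffD2, OF s(2)] lp
      using full_cycle_length[OF s] by simp
  qed
  have rest: "qsubst n ?H (phi_perm n \<sigma>) = 0" if s: "\<sigma> permutes {0..n}" and "\<sigma> \<notin> Full" for \<sigma>
  proof -
    let ?S = "{i. i < n \<and> n \<notin> set (cyc_list \<sigma> i) \<and> i = Min (set (cyc_list \<sigma> i))}"
    have "?S \<noteq> {}" using full_cycle_iff[OF s] that by (auto simp: Full_def)
    then obtain i where "i \<in> ?S" by blast
    moreover have "mtrace n (word_mat n (\<lambda>_. Phi n k) (cyc_list \<sigma> i)) = 0"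
      by (subst word_mat_eq_0[of _ n i]) (use 0 cyc_self[OF s, of i] in auto)
    ultimately have "(\<Prod>i\<in>?S. mtrace n (word_mat n (\<lambda>_. Phi n k) (cyc_list \<sigma> i))) = 0"
      by (intro prod_zero) auto
    thus ?thesis unfolding qsubst_phi_perm by simp
  qed
  have fin: "finite {\<sigma>. \<sigma> permutes {0..n}}" by (rule finite_permutations) simp
  have "(\<Sum>\<sigma>\<in>{\<sigma>. \<sigma> permutes {0..n}}. of_int (sign \<sigma>) * qsubst n ?H (phi_perm n \<sigma>))
      = (\<Sum>\<sigma>\<in>Full. of_int (sign \<sigma>) * qsubst n ?H (phi_perm n \<sigma>))"
    by (rule sum.mono_neutral_right) (use fin rest in \<open>auto simp: Full_def\<close>)
  also have "\<dots> = (\<Sum>\<sigma>\<in>Full. (-1) ^ n * k ^ n)"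
    by (rule sum.cong) (auto simp: full, auto simp: Full_def sign_full_cycle)
  \<comment> \<open>The scalar is the number of full cycles times their common sign. It is
    invertible in characteristic 0 as soon as one full cycle exists.\<close>
  also have "\<dots> = qconst (cconst (of_nat (card Full) * (-1) ^ n)) * k ^ n"
    by (simp add: cconst.hom_mult cconst.hom_power cconst.hom_uminus qconst.hom_mult
        qconst.hom_power qconst.hom_uminus cconst.hom_of_nat qconst.hom_of_nat mult.assoc)
  finally have mem: "qconst (cconst (of_nat (card Full) * (-1) ^ n)) * k ^ n \<in> CH_ideal n"
    using Q_CH_subst_mem[of n ?H, OF wf] by simp
  have "finite Full" using fin by (rule rev_finite_subset) (auto simp: Full_def)
  moreover have "Full \<noteq> {}" using full_cycle_exists[of n] by (auto simp: Full_def)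
  ultimately have "card Full > 0" by auto
  define a :: 'a where "a = of_nat (card Full) * (-1) ^ n"
  have "a \<noteq> 0" using \<open>card Full > 0\<close> by (simp add: a_def)
  hence "qconst (cconst (inverse a)) * (qconst (cconst a) * k ^ n) = k ^ n"
    by (simp flip: mult.assoc qconst.hom_mult cconst.hom_mult)
  moreover have "qconst (cconst (inverse a)) * (qconst (cconst a) * k ^ n) \<in> CH_ideal n"
    by (intro T_ideal.lmult[OF _ mem[folded a_def]]) simp
  ultimately show ?thesis by simp
qed

text \<open>In a word of length at least two the letter \<open>x\<close> has a neighbour, different
  from it by distinctness, and the product of the two already lies in the ideal. Both orders are
  assumed because \<open>x\<close> may be the last letter.\<close>

lemma list_prod_mem_T_ideal:
  fixes H :: "nat \<Rightarrow> 'a::comm_ring_1 qpoly"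
  assumes wf: "\<And>k. wf_qpoly n (H k)" and x: "x \<in> set ws" and "distinct ws" "length ws \<ge> 2"
    and mem: "\<And>l. l \<in> set ws \<Longrightarrow> l \<noteq> x \<Longrightarrow> H x * H l \<in> T_ideal n G \<and> H l * H x \<in> T_ideal n G"
  shows "list_prod H ws \<in> T_ideal n G"
proof -
  have wfl: "wf_qpoly n (list_prod H us)" for us
    by (induction us) (auto intro: wf wf_intros)
  obtain us vs where ws: "ws = us @ x # vs" using x by (meson split_list)
  show ?thesis
  proof (cases vs)
    case (Cons y vs')
    have "H x * H y \<in> T_ideal n G" using mem[of y] assms(3) ws Cons by auto
    hence "list_prod H us * ((H x * H y) * list_prod H vs') \<in> T_ideal n G"
      by (intro T_ideal.lmult[OF wfl] T_ideal.rmult[OF wfl])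
    thus ?thesis by (simp add: ws Cons list_prod_append mult.assoc)
  next
    case Nil
    with ws assms(4) have "us \<noteq> []" by auto
    then obtain us' y where us: "us = us' @ [y]" by (metis rev_exhaust)
    have "H y * H x \<in> T_ideal n G" using mem[of y] assms(3) ws us by auto
    hence "list_prod H us' * (H y * H x) \<in> T_ideal n G"
      by (intro T_ideal.lmult[OF wfl])
    thus ?thesis by (simp add: ws us Nil list_prod_append mult.assoc)
  qed
qed

lemma cyc_list_fixpoint: "\<sigma> i = i \<Longrightarrow> cyc_list \<sigma> i = [i]"
proof -
  assume "\<sigma> i = i"
  hence "cyc_len \<sigma> i = 1" unfolding cyc_len_def by (intro Least_equality) auto
  thus ?thesis by (simp add: cyc_list_def)
qed

lemma cyc_list_swap: "\<sigma> i = j \<Longrightarrow> \<sigma> j = i \<Longrightarrow> i \<noteq> j \<Longrightarrow> cyc_list \<sigma> i = [i, j]"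
proof -
  assume s: "\<sigma> i = j" "\<sigma> j = i" "i \<noteq> j"
  have "cyc_len \<sigma> i = 2" unfolding cyc_len_def
  proof (rule Least_equality)
    show "0 < (2::nat) \<and> (\<sigma> ^^ 2) i = i" using s by (simp add: numeral_2_eq_2)
    fix k assume "0 < k \<and> (\<sigma> ^^ k) i = i"
    thus "2 \<le> k" using s by (cases "k = 1") auto
  qed
  thus ?thesis using s by (simp add: cyc_list_def numeral_2_eq_2)
qed

text \<open>When the first argument \<open>H 0\<close> has vanishing traces and annihilates the other arguments,
  only the transposition of \<open>0\<close> and \<open>n\<close> contributes to the Cayley--Hamilton polynomial.\<close>

theorem ker_Phi_annihilated:
  fixes H :: "nat \<Rightarrow> 'a::comm_ring_1 qpoly"
  assumes n: "n \<ge> 1" and wf: "\<And>k. wf_qpoly n (H k)" and 0: "Phi n (H 0) = 0\<^sub>m n n"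
    and orth: "\<And>l l'. l \<in> {1..<n} \<Longrightarrow> l' \<in> {1..<n} \<Longrightarrow> l \<noteq> l' \<Longrightarrow> Phi n (H l) * Phi n (H l') = 0\<^sub>m n n"
    and ann: "\<And>l. l \<in> {1..<n} \<Longrightarrow> H 0 * H l \<in> CH_ideal n \<and> H l * H 0 \<in> CH_ideal n"
  shows "qconst (\<Prod>l\<in>{1..<n}. mtrace n (Phi n (H l))) * H 0 \<in> CH_ideal n"
proof -
  let ?A = "\<lambda>k. Phi n (H k)"
  let ?\<tau> = "transpose 0 n"
  let ?S = "\<lambda>\<sigma>. {i. i < n \<and> n \<notin> set (cyc_list \<sigma> i) \<and> i = Min (set (cyc_list \<sigma> i))}"
  have zero: "qsubst n H (phi_perm n \<sigma>) \<in> CH_ideal n"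
    if "i \<in> ?S \<sigma>" "word_mat n ?A (cyc_list \<sigma> i) = 0\<^sub>m n n" for \<sigma> i
  proof -
    have "(\<Prod>i\<in>?S \<sigma>. mtrace n (word_mat n ?A (cyc_list \<sigma> i))) = 0"
      by (intro prod_zero bexI[of _ i]) (use that in auto)
    thus ?thesis unfolding qsubst_phi_perm by (simp add: T_ideal.zero)
  qed
  have rest: "qsubst n H (phi_perm n \<sigma>) \<in> CH_ideal n"
    if s: "\<sigma> permutes {0..n}" and ne: "\<sigma> \<noteq> ?\<tau>" for \<sigma>
  proof (cases "n \<in> set (cyc_list \<sigma> 0)")
    \<comment> \<open>The cycle of 0 avoids \<open>n\<close> and has minimum 0, so it gives a trace
      factor containing \<open>Phi n (H 0)\<close>, which vanishes.\<close>
    case False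
    have "Min (set (cyc_list \<sigma> 0)) \<le> 0" using cyc_self[OF s, of 0] by (intro Min_le) auto
    hence "0 \<in> ?S \<sigma>" using False n by auto
    thus ?thesis
      by (rule zero) (rule word_mat_eq_0[of _ n 0], use cyc_self[OF s, of 0] 0 in auto)
  next
    case True
    let ?t = "tl (cyc_list \<sigma> n)"
    have eq0: "set (cyc_list \<sigma> n) = set (cyc_list \<sigma> 0)" by (rule cyc_eq[OF s True])
    have cn: "cyc_list \<sigma> n = n # ?t" by (rule cyc_Cons[OF s])
    have dist: "distinct ?t" "n \<notin> set ?t" using cyc_distinct[OF s, of n] cn
      by (metis distinct.simps(2))+
    have 0: "0 \<in> set ?t" using cyc_self[OF s, of 0] eq0 cn n
      by (metis set_ConsD not_one_le_zero)
    have sub: "set ?t \<subseteq> {0..<n}"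
    proof
      fix x assume "x \<in> set ?t"
      moreover from this have "x \<in> set (cyc_list \<sigma> n)" using cn by (metis list.set_intros(2))
      ultimately show "x \<in> {0..<n}" using cyc_subset[OF s, of n] dist(2) by (cases "x = n") auto
    qed
    show ?thesis
    \<comment> \<open>Now \<open>H 0\<close> stands in the product outside of the traces. Any
      neighbour there is one of the annihilated arguments; without a neighbour, \<sigma> must
      exchange 0 and \<open>n\<close>.\<close>
    proof (cases "length ?t \<ge> 2")
      case True
      have "list_prod H ?t \<in> CH_ideal n"
      proof (rule list_prod_mem_T_ideal[OF wf 0 dist(1) True])
        fix l assume "l \<in> set ?t" "l \<noteq> 0"
        thus "H 0 * H l \<in> CH_ideal n \<and> H l * H 0 \<in> CH_ideal n" using sub by (intro ann) auto
      qed
      thus ?thesis unfolding qsubst_phi_perm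
        by (rule T_ideal.lmult[rotated]) (auto simp: mtrace_def intro!: wf_intros wf_word_mat_Phi[OF wf])
    next
      case False
      hence "length ?t = 1" using 0 by (cases ?t) (auto simp: not_le less_Suc_eq)
      then obtain a where "?t = [a]" by (cases ?t) auto
      with 0 have t0: "?t = [0]" by auto
      hence c: "cyc_list \<sigma> n = [n, 0]" using cn by simp
      have \<sigma>n: "\<sigma> n = 0"
      proof (rule ccontr)
        assume "\<sigma> n \<noteq> 0"
        hence "\<sigma> n = n" using cyc_step[OF s, of n] c by auto
        from cyc_list_fixpoint[of \<sigma>, OF this] c show False by simp
      qed
      have \<sigma>0: "\<sigma> 0 = n"
      proof (rule ccontr)
        assume "\<sigma> 0 \<noteq> n"
        hence "\<sigma> 0 = 0" using cyc_step[OF s, of 0] eq0 c by auto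
        hence "\<sigma> 0 = \<sigma> n" using \<sigma>n by simp
        hence "0 = n" using permutes_inj[OF s] by (simp only: inj_eq)
        with n show False by simp
      qed
      \<comment> \<open>A permutation that exchanges 0 and \<open>n\<close> without being the
        transposition moves a further point. Its cycle stays inside {1..<n} and has two different
        adjacent letters, whose matrices are orthogonal, so this trace vanishes.\<close>
      obtain x where x: "\<sigma> x \<noteq> ?\<tau> x" using ne by blast
      have x0: "x \<noteq> 0" "x \<noteq> n" using x \<sigma>0 \<sigma>n by (metis transpose_apply_first, metis transpose_apply_second)
      hence \<sigma>x: "\<sigma> x \<noteq> x" using x by simp
      have xn: "x \<le> n" using permutes_not_in[OF s, of x] \<sigma>x by auto
      have "set (cyc_list \<sigma> n) \<noteq> set (cyc_list \<sigma> x)"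
        using c cyc_self[OF s, of x] x0 by auto
      hence nn: "n \<notin> set (cyc_list \<sigma> x)" and n0: "0 \<notin> set (cyc_list \<sigma> x)"
        using cyc_eq[OF s, of n x] cyc_eq[OF s, of 0 x] eq0 by auto
      let ?m = "Min (set (cyc_list \<sigma> x))"
      have setm: "set (cyc_list \<sigma> ?m) = set (cyc_list \<sigma> x)" by (rule Min_cyc_mem(2)[OF s xn nn])
      have "{x, \<sigma> x} \<subseteq> set (cyc_list \<sigma> ?m)"
        unfolding setm using cyc_self[OF s] cyc_step[OF s] by auto
      hence "card {x, \<sigma> x} \<le> card (set (cyc_list \<sigma> ?m))" by (intro card_mono) auto
      hence "length (cyc_list \<sigma> ?m) \<ge> 2"
        using \<sigma>x distinct_card[OF cyc_distinct[OF s]] by simp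
      then obtain a b r where abr: "cyc_list \<sigma> ?m = a # b # r"
        by (metis One_nat_def Suc_1 Suc_le_length_iff)
      have ab: "a \<noteq> b" using cyc_distinct[OF s, of ?m] abr by auto
      have "{a, b} \<subseteq> set (cyc_list \<sigma> x)" using setm abr by auto
      moreover have "set (cyc_list \<sigma> x) \<subseteq> {1..<n}"
      proof
        fix y assume y: "y \<in> set (cyc_list \<sigma> x)"
        have "y \<noteq> 0" using y n0 by metis
        moreover have "y \<noteq> n" using y nn by metis
        moreover have "y \<le> n" using y cyc_subset[OF s xn] by auto
        ultimately show "y \<in> {1..<n}" by simp
      qed
      ultimately have "?A a * ?A b = 0\<^sub>m n n" using ab by (intro orth) auto
      moreover have "word_mat n ?A (cyc_list \<sigma> ?m) = (?A a * ?A b) * word_mat n ?A r"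
        unfolding abr by (simp add: assoc_mult_mat[OF Phi_carrier Phi_carrier word_mat_carrier])
      ultimately have "word_mat n ?A (cyc_list \<sigma> ?m) = 0\<^sub>m n n"
        by (simp add: left_mult_zero_mat[OF word_mat_carrier])
      thus ?thesis by (rule zero[OF Min_cyc_mem(1)[OF s xn nn]])
    qed
  qed
  have \<tau>: "?\<tau> permutes {0..n}" by (rule permutes_swap_id) auto
  have cn: "cyc_list ?\<tau> n = [n, 0]" using n by (intro cyc_list_swap) auto
  have c0: "cyc_list ?\<tau> 0 = [0, n]" using n by (intro cyc_list_swap) auto
  have ci: "cyc_list ?\<tau> i = [i]" if "i \<in> {1..<n}" for i
    using that by (intro cyc_list_fixpoint) auto
  have "i \<in> ?S ?\<tau> \<longleftrightarrow> i \<in> {1..<n}" for i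
  proof (cases "i \<in> {1..<n}")
    case True
    thus ?thesis using ci[OF True] by auto
  next
    case False
    show ?thesis
    proof (cases "i = 0")
      case True
      thus ?thesis using c0 by simp
    next
      case i0: False
      with False show ?thesis by simp
    qed
  qed
  hence S: "?S ?\<tau> = {1..<n}" by blast
  have swap_term: "qsubst n H (phi_perm n ?\<tau>) = qconst (\<Prod>l\<in>{1..<n}. mtrace n (?A l)) * H 0"
    unfolding qsubst_phi_perm S cn
    by (intro arg_cong2[where f = "(*)"] arg_cong[where f = qconst] prod.cong)
      (simp_all add: ci right_mult_one_mat[OF Phi_carrier])
  let ?P = "{\<sigma>. \<sigma> permutes {0..n}}"
  let ?f = "\<lambda>\<sigma>. of_int (sign \<sigma>) * qsubst n H (phi_perm n \<sigma>)"
  have "(\<Sum>\<sigma>\<in>?P. ?f \<sigma>) = ?f ?\<tau> + (\<Sum>\<sigma>\<in>?P - {?\<tau>}. ?f \<sigma>)"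
    by (rule sum.remove) (use \<tau> finite_permutations[of "{0..n}"] in auto)
  hence eq: "?f ?\<tau> = (\<Sum>\<sigma>\<in>?P. ?f \<sigma>) - (\<Sum>\<sigma>\<in>?P - {?\<tau>}. ?f \<sigma>)"
    by (simp only: add_diff_cancel_right')
  have "?f \<sigma> \<in> CH_ideal n" if "\<sigma> \<in> ?P - {?\<tau>}" for \<sigma>
    by (rule T_ideal.lmult[OF wf_qpoly_of_int rest]) (use that in auto)
  hence "(\<Sum>\<sigma>\<in>?P - {?\<tau>}. ?f \<sigma>) \<in> CH_ideal n" by (rule T_ideal_sum)
  hence "?f ?\<tau> \<in> CH_ideal n"
    unfolding eq by (rule T_ideal_minus[OF Q_CH_subst_mem[of n H, OF wf]])
  moreover have "sign ?\<tau> = -1" using n by (simp add: sign_swap_id)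
  ultimately have "- (qconst (\<Prod>l\<in>{1..<n}. mtrace n (?A l)) * H 0) \<in> CH_ideal n"
    unfolding swap_term by simp
  from T_ideal_uminus[OF this] show ?thesis by simp
qed

section \<open>Evaluations determine polynomials\<close>

text \<open>The sums are the values of one univariate polynomial that vanishes on an infinite field.
  Several indices may share an exponent, so only the total coefficient of each degree is known to
  vanish.\<close>

lemma infinite_field_coeff_eq_0:
  fixes b :: "'m \<Rightarrow> 'a::field_char_0" and e :: "'m \<Rightarrow> nat"
  assumes "finite S" and "\<And>x. (\<Sum>m\<in>S. b m * x ^ e m) = 0"
  shows "(\<Sum>m\<in>{m\<in>S. e m = d}. b m) = 0"
proof -
  let ?p = "\<Sum>m\<in>S. monom (b m) (e m)"
  have "poly ?p x = 0" for x using assms(2)[of x] by (simp add: poly_sum poly_monom)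
  hence "?p = 0" using poly_all_0_iff_0[of ?p] by blast
  hence "coeff ?p d = 0" by simp
  hence "(\<Sum>m\<in>S. if e m = d then b m else 0) = 0"
    by (simp add: coeff_sum)
  thus ?thesis using assms(1) by (simp add: sum.inter_filter)
qed

text \<open>The variables are treated one at a time, each restricting the index set to the monomials
  with the exponent prescribed by \<open>d\<close>.\<close>

lemma infinite_field_monomial_coeff_eq_0:
  fixes b :: "('v \<Rightarrow>\<^sub>0 nat) \<Rightarrow> 'a::field_char_0"
  assumes "finite V" "finite S"
    and "\<And>t. (\<Sum>m\<in>S. b m * (\<Prod>v\<in>V. t v ^ Poly_Mapping.lookup m v)) = 0"
  shows "(\<Sum>m\<in>{m\<in>S. \<forall>v\<in>V. Poly_Mapping.lookup m v = Poly_Mapping.lookup d v}. b m) = 0"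
  using assms
proof (induction V arbitrary: S rule: finite_induct)
  case empty
  thus ?case by simp
next
  case (insert v V)
  let ?l = "Poly_Mapping.lookup"
  let ?S = "{m\<in>S. ?l m v = ?l d v}"
  have "(\<Sum>m\<in>?S. b m * (\<Prod>u\<in>V. t u ^ ?l m u)) = 0" for t
  proof (rule infinite_field_coeff_eq_0[OF insert.prems(1)])
    fix x :: 'a
    have "(\<Prod>u\<in>V. (t(v := x)) u ^ ?l m u) = (\<Prod>u\<in>V. t u ^ ?l m u)" for m
      using insert.hyps by (intro prod.cong) auto
    thus "(\<Sum>m\<in>S. b m * (\<Prod>u\<in>V. t u ^ ?l m u) * x ^ ?l m v) = 0"
      using insert.prems(2)[of "t(v := x)"] insert.hyps by (simp add: ac_simps)
  qed
  from insert.IH[of ?S, OF _ this] insert.prems(1) show ?case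
    by (simp add: conj_assoc)
qed

text \<open>Because of \<open>wf_cpoly\<close>, each variable is a genuine entry of an n by n matrix
  and can be given any value independently of the others.\<close>

lemma ceval_eq_0_imp:
  fixes c :: "'a::field_char_0 cpoly"
  assumes wf: "wf_cpoly n c"
    and 0: "\<And>A. (\<And>k. A k \<in> carrier_mat n n) \<Longrightarrow> ceval A c = 0"
  shows "c = 0"
proof (rule poly_mapping_eqI)
  fix d :: cmon
  let ?K = "Poly_Mapping.keys c"
  \<comment> \<open>The variables of \<open>d\<close> are included so that agreement with
    \<open>d\<close> on \<open>?V\<close> forces equality of the monomials.\<close>
  let ?V = "\<Union>(Poly_Mapping.keys ` ?K) \<union> Poly_Mapping.keys d"
  have fin: "finite ?V" by simp
  have "(\<Sum>m\<in>?K. Poly_Mapping.lookup c m * (\<Prod>v\<in>?V. t v ^ Poly_Mapping.lookup m v)) = 0" for t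
  proof -
    let ?A = "\<lambda>k. mat n n (\<lambda>(i,j). t (k,i,j))"
    have "(\<Prod>v\<in>?V. t v ^ Poly_Mapping.lookup m v) =
        mon_eval (\<lambda>v. case v of (k,i,j) \<Rightarrow> ?A k $$ (i,j)) m" if "m \<in> ?K" for m
    proof -
      have "(\<Prod>v\<in>?V. t v ^ Poly_Mapping.lookup m v) = mon_eval t m"
        using that by (intro mon_eval_superset[symmetric] fin) auto
      also have "\<dots> = mon_eval (\<lambda>v. case v of (k,i,j) \<Rightarrow> ?A k $$ (i,j)) m"
        unfolding mon_eval_def
      proof (rule prod.cong)
        fix v assume v: "v \<in> Poly_Mapping.keys m"
        obtain k i j where kij: "v = (k,i,j)" by (cases v)
        have "fst (snd v) < n \<and> snd (snd v) < n" using wf that v unfolding wf_cpoly_def by blast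
        hence "i < n" "j < n" by (auto simp: kij)
        thus "t v ^ Poly_Mapping.lookup m v = (case v of (k,i,j) \<Rightarrow> ?A k $$ (i,j)) ^ Poly_Mapping.lookup m v"
          by (simp add: kij)
      qed simp
      finally show ?thesis .
    qed
    hence "(\<Sum>m\<in>?K. Poly_Mapping.lookup c m * (\<Prod>v\<in>?V. t v ^ Poly_Mapping.lookup m v)) = ceval ?A c"
      unfolding ceval_pm_sum pm_sum_def by (intro sum.cong) auto
    thus ?thesis using 0[of ?A] by simp
  qed
  from infinite_field_monomial_coeff_eq_0[OF fin finite_keys this, of d]
  have "(\<Sum>m\<in>{m\<in>?K. \<forall>v\<in>?V. Poly_Mapping.lookup m v = Poly_Mapping.lookup d v}. Poly_Mapping.lookup c m) = 0" .
  moreover have "{m\<in>?K. \<forall>v\<in>?V. Poly_Mapping.lookup m v = Poly_Mapping.lookup d v} = {m\<in>?K. m = d}"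
  proof -
    have "m = d" if m: "m \<in> ?K" and eq: "\<forall>v\<in>?V. Poly_Mapping.lookup m v = Poly_Mapping.lookup d v" for m
    proof (rule poly_mapping_eqI)
      fix v
      show "Poly_Mapping.lookup m v = Poly_Mapping.lookup d v"
      proof (cases "v \<in> ?V")
        case False
        hence "v \<notin> Poly_Mapping.keys m" "v \<notin> Poly_Mapping.keys d" using m by auto
        thus ?thesis by (simp add: in_keys_iff)
      qed (use eq in blast)
    qed
    thus ?thesis by auto
  qed
  moreover have "{m\<in>?K. m = d} = (if d \<in> ?K then {d} else {})" by auto
  ultimately show "Poly_Mapping.lookup c d = Poly_Mapping.lookup 0 d"
    by (auto simp: in_keys_iff split: if_splits)
qed

lemma ceval_word_mat:
  fixes A :: "nat \<Rightarrow> 'a::comm_ring_1 mat"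
  assumes "\<And>k. A k \<in> carrier_mat n n" "i < n" "j < n"
  shows "ceval A (word_mat n (gen_mat n) ws $$ (i,j)) = word_mat n A ws $$ (i,j)"
proof -
  have "map_mat (ceval A) (gen_mat n k) = A k" for k
    by (rule eq_matI) (use assms(1)[of k] in \<open>auto simp: gen_mat_def ceval_cvar\<close>)
  hence "map_mat (ceval A) (word_mat n (gen_mat n) ws) = word_mat n A ws"
    using ceval.word_mat_hom[of "gen_mat n" n A ws] by simp
  from arg_cong[OF this, of "\<lambda>M. M $$ (i,j)"] show ?thesis
    using assms(2,3) by simp
qed

lemma ceval_Phi:
  fixes A :: "nat \<Rightarrow> 'a::comm_ring_1 mat"
  assumes "\<And>k. A k \<in> carrier_mat n n" "i < n" "j < n"
  shows "ceval A (Phi n p $$ (i,j)) = qeval n A p $$ (i,j)"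
  using assms(2,3)
  by (simp add: Phi_def qeval_def ceval.hom_sum ceval.hom_mult ceval_word_mat[OF assms(1)])

lemma quasi_identity_imp_Phi_0:
  fixes P :: "'a::field_char_0 qpoly"
  assumes "wf_qpoly n P" "quasi_identity n P"
  shows "Phi n P = 0\<^sub>m n n"
proof (rule eq_matI)
  fix i j assume "i < dim_row (0\<^sub>m n n :: 'a cpoly mat)" "j < dim_col (0\<^sub>m n n :: 'a cpoly mat)"
  hence ij: "i < n" "j < n" by auto
  have "Phi n P $$ (i,j) = 0"
    by (rule ceval_eq_0_imp[of n])
      (use assms ij in \<open>auto simp: ceval_Phi quasi_identity_def intro: wf_Phi\<close>)
  thus "Phi n P $$ (i,j) = 0\<^sub>m n n $$ (i,j)" using ij by simp
qed auto

text \<open>This rests on the fundamental trace identity of n by n matrices, the alternating sum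
  over the permutations of n + 1 points of products of traces along cycles. The identity permutation
  contributes the power of the trace; every other one has a cycle of length at least two, hence a
  factor from the square of \<open>G\<close>. The set \<open>S\<close> records the multipliers under
  which \<open>J\<close> is closed, in the application the polynomials in matrix entries.\<close>

lemma trace_nilpotent_mod_ideal:
  fixes G :: "nat \<Rightarrow> nat \<Rightarrow> 'r::comm_ring_1"
  assumes S: "\<And>i j. i < n \<Longrightarrow> j < n \<Longrightarrow> S (G i j)" "S 1" "S (-1)" "\<And>x y. S x \<Longrightarrow> S y \<Longrightarrow> S (x * y)"
    and J: "0 \<in> J" "\<And>x y. x \<in> J \<Longrightarrow> y \<in> J \<Longrightarrow> x + y \<in> J" "\<And>x y. S x \<Longrightarrow> y \<in> J \<Longrightarrow> x * y \<in> J"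
    and sq: "\<And>i j. i < n \<Longrightarrow> j < n \<Longrightarrow> (\<Sum>l<n. G i l * G l j) \<in> J"
  shows "(\<Sum>i<n. G i i) ^ Suc n \<in> J"
proof -
  let ?N = "{0..<Suc n}"
  let ?F = "PiE ?N (\<lambda>_. {..<n})"
  let ?P = "{\<sigma>. \<sigma> permutes ?N}"
  have Jsum: "(\<Sum>x\<in>X. f x) \<in> J" if "\<And>x. x \<in> X \<Longrightarrow> f x \<in> J" for f and X :: "'x set"
    using that by (induction X rule: infinite_finite_induct) (auto intro: J)
  have Sprod: "S (\<Prod>x\<in>X. f x)" if "\<And>x. x \<in> X \<Longrightarrow> S (f x)" for f and X :: "'x set"
    using that by (induction X rule: infinite_finite_induct) (auto intro: S)
  \<comment> \<open>Expanded into index assignments, this is the product over the cycles of \<sigma>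
    of the traces of powers of \<open>G\<close>.\<close>
  define Z where "Z = (\<lambda>\<sigma>. \<Sum>f\<in>?F. \<Prod>s\<in>?N. G (f s) (f (\<sigma> s)))"
  \<comment> \<open>An assignment of n values to n + 1 positions repeats a value, which makes two
    rows of a determinant equal.\<close>
  have det0: "(\<Sum>\<sigma>\<in>?P. signof \<sigma> * (\<Prod>s\<in>?N. G (f s) (f (\<sigma> s)))) = 0" if f: "f \<in> ?F" for f
  proof -
    let ?M = "mat (Suc n) (Suc n) (\<lambda>(s,t). G (f s) (f t))"
    have "\<not> inj_on f ?N"
    proof
      assume "inj_on f ?N"
      hence "card ?N \<le> card {..<n}" using f by (intro card_inj_on_le[of f]) (auto simp: PiE_def)
      thus False by simp
    qed
    then obtain s t where st: "s \<in> ?N" "t \<in> ?N" "s \<noteq> t" "f s = f t" by (auto simp: inj_on_def)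
    have "det ?M = 0"
      by (rule det_identical_rows[of _ "Suc n" s t]) (use st in auto)
    moreover have "det ?M = (\<Sum>\<sigma>\<in>?P. signof \<sigma> * (\<Prod>s\<in>?N. ?M $$ (s, \<sigma> s)))"
      by (rule det_def') auto
    moreover have "(\<Prod>s\<in>?N. ?M $$ (s, \<sigma> s)) = (\<Prod>s\<in>?N. G (f s) (f (\<sigma> s)))" if "\<sigma> \<in> ?P" for \<sigma>
    proof (rule prod.cong)
      fix s assume "s \<in> ?N"
      moreover from this have "\<sigma> s \<in> ?N" using that permutes_in_image[of \<sigma> ?N s] by simp
      ultimately show "?M $$ (s, \<sigma> s) = G (f s) (f (\<sigma> s))" by auto
    qed simp
    ultimately show ?thesis by simp
  qed
  have "(\<Sum>\<sigma>\<in>?P. signof \<sigma> * Z \<sigma>) = (\<Sum>f\<in>?F. \<Sum>\<sigma>\<in>?P. signof \<sigma> * (\<Prod>s\<in>?N. G (f s) (f (\<sigma> s))))"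
    unfolding Z_def sum_distrib_left by (rule sum.swap)
  also have "\<dots> = 0" by (rule sum.neutral) (use det0 in blast)
  finally have tot: "(\<Sum>\<sigma>\<in>?P. signof \<sigma> * Z \<sigma>) = 0" .
  have Zid: "Z id = (\<Sum>i<n. G i i) ^ Suc n"
  proof -
    have "(\<Prod>s\<in>?N. \<Sum>i\<in>{..<n}. G i i) = (\<Sum>f\<in>?F. \<Prod>s\<in>?N. G (f s) (f s))"
      by (rule prod_sum_PiE) auto
    thus ?thesis unfolding Z_def by simp
  qed
  have ZJ: "Z \<sigma> \<in> J" if p: "\<sigma> permutes ?N" and ne: "\<sigma> \<noteq> id" for \<sigma>
  proof -
    \<comment> \<open>Only the factors at \<open>s\<close> and at t = \<sigma> s involve the index
      attached to \<open>t\<close>. Summing over that index alone contracts them to an entry of the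
      square of \<open>G\<close>.\<close>
    obtain s where s: "\<sigma> s \<noteq> s" using ne by (auto simp: fun_eq_iff)
    define t where "t = \<sigma> s"
    have sN: "s \<in> ?N" using s permutes_not_in[OF p] by blast
    have tN: "t \<in> ?N" using permutes_in_image[OF p] sN t_def by blast
    have inj: "inj \<sigma>" using p by (rule permutes_inj)
    have st: "s \<noteq> t" using s t_def by simp
    have tt: "\<sigma> t \<noteq> t" using s t_def inj by (auto simp: inj_eq)
    let ?R = "?N - {t}"
    have N: "insert t ?R = ?N" using tN by blast
    have "Z \<sigma> = (\<Sum>(x,g)\<in>{..<n} \<times> PiE ?R (\<lambda>_. {..<n}). \<Prod>u\<in>?N. G ((g(t := x)) u) ((g(t := x)) (\<sigma> u)))"
    proof -
      have "?F = (\<lambda>(x,g). g(t := x)) ` ({..<n} \<times> PiE ?R (\<lambda>_. {..<n}))"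
        using PiE_insert_eq[of t ?R "\<lambda>_. {..<n}"] unfolding N .
      thus ?thesis
        unfolding Z_def using inj_combinator[of t ?R "\<lambda>_. {..<n}"]
        by (simp add: sum.reindex case_prod_unfold)
    qed
    also have "\<dots> = (\<Sum>g\<in>PiE ?R (\<lambda>_. {..<n}). \<Sum>x<n. \<Prod>u\<in>?N. G ((g(t := x)) u) ((g(t := x)) (\<sigma> u)))"
      by (subst sum.swap) (simp add: sum.cartesian_product)
    also have "\<dots> \<in> J"
    proof (rule Jsum)
      fix g assume g: "g \<in> PiE ?R (\<lambda>_. {..<n})"
      have gn: "g u < n" if "u \<in> ?R" for u using g that by (auto simp: PiE_iff)
      let ?r = "\<Prod>u\<in>?R - {s}. G (g u) (g (\<sigma> u))"
      have eq: "(\<Prod>u\<in>?N. G ((g(t := x)) u) ((g(t := x)) (\<sigma> u))) = ?r * (G (g s) x * G x (g (\<sigma> t)))" for x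
      proof -
        let ?h = "\<lambda>u. G ((g(t := x)) u) ((g(t := x)) (\<sigma> u))"
        have "(\<Prod>u\<in>?N. ?h u) = ?h t * (\<Prod>u\<in>?R. ?h u)"
          by (rule prod.remove) (use tN in auto)
        also have "(\<Prod>u\<in>?R. ?h u) = ?h s * (\<Prod>u\<in>?R - {s}. ?h u)"
          by (rule prod.remove) (use sN st in auto)
        also have "(\<Prod>u\<in>?R - {s}. ?h u) = ?r"
        proof (rule prod.cong)
          fix u assume u: "u \<in> ?R - {s}"
          hence "\<sigma> u \<noteq> t" using inj t_def by (auto simp: inj_eq)
          thus "?h u = G (g u) (g (\<sigma> u))" using u by auto
        qed simp
        also have "?h t = G x (g (\<sigma> t))" using tt by simp
        also have "?h s = G (g s) x" using st t_def by simp
        finally show ?thesis by (simp add: ac_simps)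
      qed
      have R: "\<sigma> u \<in> ?R" if "u \<in> ?N" "u \<noteq> s" for u
        using that permutes_in_image[OF p] inj t_def by (auto simp: inj_eq)
      have "S ?r" by (rule Sprod) (auto intro!: S gn R)
      moreover have "(\<Sum>x<n. G (g s) x * G x (g (\<sigma> t))) \<in> J"
        by (rule sq) (use st sN tN R[of t] in \<open>auto intro!: gn\<close>)
      ultimately have "?r * (\<Sum>x<n. G (g s) x * G x (g (\<sigma> t))) \<in> J" by (rule J)
      thus "(\<Sum>x<n. \<Prod>u\<in>?N. G ((g(t := x)) u) ((g(t := x)) (\<sigma> u))) \<in> J"
        unfolding eq by (simp add: sum_distrib_left)
    qed
    finally show ?thesis .
  qed
  have "(\<Sum>\<sigma>\<in>?P. signof \<sigma> * Z \<sigma>) = signof id * Z id + (\<Sum>\<sigma>\<in>?P - {id}. signof \<sigma> * Z \<sigma>)"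
    by (rule sum.remove) (auto simp: finite_permutations permutes_id)
  hence "Z id = - 1 * (\<Sum>\<sigma>\<in>?P - {id}. signof \<sigma> * Z \<sigma>)"
    using tot by (simp add: eq_neg_iff_add_eq_0)
  moreover have "(\<Sum>\<sigma>\<in>?P - {id}. signof \<sigma> * Z \<sigma>) \<in> J"
  proof (rule Jsum)
    fix \<sigma> assume "\<sigma> \<in> ?P - {id}"
    hence "Z \<sigma> \<in> J" using ZJ by blast
    moreover have "S (signof \<sigma>)" using S by (simp add: sign_def)
    ultimately show "signof \<sigma> * Z \<sigma> \<in> J" by (rule J(3)[rotated])
  qed
  ultimately have "Z id \<in> J" using J(3)[OF S(3)] by simp
  thus ?thesis unfolding Zid .
qed

section \<open>The conductor of the algebra of generic matrices\<close>

definition gen_alg :: "nat \<Rightarrow> 'a::comm_ring_1 cpoly mat set" where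
  "gen_alg n = {Phi n p | p. wf_qpoly n p}"

lemma gen_algI: "wf_qpoly n p \<Longrightarrow> Phi n p \<in> gen_alg n"
  by (auto simp: gen_alg_def)

lemma gen_alg_carrier: "M \<in> gen_alg n \<Longrightarrow> M \<in> carrier_mat n n"
  by (auto simp: gen_alg_def)

lemma gen_alg_wf: "M \<in> gen_alg n \<Longrightarrow> i < n \<Longrightarrow> j < n \<Longrightarrow> wf_cpoly n (M $$ (i,j))"
  by (auto simp: gen_alg_def wf_Phi)

lemma gen_alg_mult: "M \<in> gen_alg n \<Longrightarrow> N \<in> gen_alg n \<Longrightarrow> M * N \<in> gen_alg n"
  unfolding gen_alg_def by (auto simp: Phi_mult[symmetric] intro: wf_intros)

lemma gen_alg_smult: "wf_cpoly n a \<Longrightarrow> M \<in> gen_alg n \<Longrightarrow> a \<cdot>\<^sub>m M \<in> gen_alg n"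
proof -
  assume a: "wf_cpoly n a" and "M \<in> gen_alg n"
  then obtain p where p: "wf_qpoly n p" "M = Phi n p" by (auto simp: gen_alg_def)
  have "Phi n (qconst a * p) \<in> gen_alg n" using a p by (intro gen_algI wf_qpoly_mult) auto
  thus ?thesis by (simp add: p Phi_qconst_mult)
qed

lemma gen_alg_sumI:
  assumes "\<And>t. t \<in> T \<Longrightarrow> M t \<in> gen_alg n" and N: "N \<in> carrier_mat n n"
    and eq: "\<And>i j. i < n \<Longrightarrow> j < n \<Longrightarrow> N $$ (i,j) = (\<Sum>t\<in>T. M t $$ (i,j))"
  shows "N \<in> gen_alg n"
proof -
  have "\<forall>t\<in>T. \<exists>p. wf_qpoly n p \<and> M t = Phi n p" using assms(1) by (auto simp: gen_alg_def)
  then obtain p where p: "\<And>t. t \<in> T \<Longrightarrow> wf_qpoly n (p t) \<and> M t = Phi n (p t)" by metis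
  have "N = Phi n (\<Sum>t\<in>T. p t)"
    by (rule eq_matI) (use N p in \<open>auto simp: eq Phi_sum_entry\<close>)
  moreover have "wf_qpoly n (\<Sum>t\<in>T. p t)" using p by (auto intro: wf_qpoly_sum)
  ultimately show ?thesis by (auto simp: gen_alg_def)
qed

lemma word_mat_gen_alg: "word_mat n (gen_mat n) ws \<in> gen_alg n"
proof -
  have "wf_qpoly n (Poly_Mapping.single (Word ws) (1 :: 'a cpoly))" by (simp add: wf_qpoly_single)
  from gen_algI[OF this] have "1 \<cdot>\<^sub>m word_mat n (gen_mat n) ws \<in> (gen_alg n :: 'a cpoly mat set)"
    by (simp add: Phi_single)
  moreover have "1 \<cdot>\<^sub>m word_mat n (gen_mat n) ws = (word_mat n (gen_mat n) ws :: 'a cpoly mat)" by auto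
  ultimately show ?thesis by simp
qed

lemma gen_mat_gen_alg: "gen_mat n k \<in> gen_alg n"
  using word_mat_gen_alg[of n "[k]"] by (simp add: right_mult_one_mat[OF gen_mat_carrier])

definition elem_mat :: "nat \<Rightarrow> 'b::zero \<Rightarrow> nat \<Rightarrow> nat \<Rightarrow> 'b mat" where
  "elem_mat n r i j = mat n n (\<lambda>(p,q). if p = i \<and> q = j then r else 0)"

text \<open>The conductor of the full matrix algebra into the algebra of generic matrices: by
  linearity, \<open>r\<close> multiplies every matrix over the coefficient ring into
  \<open>gen_alg n\<close> once it does so for the matrix units.\<close>

definition conductor :: "nat \<Rightarrow> 'a::comm_ring_1 cpoly set" where
  "conductor n = {r. wf_cpoly n r \<and> (\<forall>i<n. \<forall>j<n. elem_mat n r i j \<in> gen_alg n)}"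

lemma conductor_mult: "wf_cpoly n a \<Longrightarrow> r \<in> conductor n \<Longrightarrow> a * r \<in> conductor n"
proof -
  assume a: "wf_cpoly n a" and r: "r \<in> conductor n"
  have "elem_mat n (a * r) i j = a \<cdot>\<^sub>m elem_mat n r i j" for i j
    by (rule eq_matI) (auto simp: elem_mat_def)
  thus ?thesis using a r by (auto simp: conductor_def intro: wf_intros gen_alg_smult)
qed

lemma conductor_0: "(0 :: 'a::comm_ring_1 cpoly) \<in> conductor n"
proof -
  have "elem_mat n 0 i j = (Phi n 0 :: 'a cpoly mat)" for i j
    by (rule eq_matI) (auto simp: elem_mat_def)
  hence "elem_mat n 0 i j \<in> (gen_alg n :: 'a cpoly mat set)" for i j
    using gen_algI[OF wf_qpoly_0] by metis
  thus ?thesis by (auto simp: conductor_def)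
qed

lemma conductor_add: "r \<in> conductor n \<Longrightarrow> s \<in> conductor n \<Longrightarrow> r + s \<in> conductor n"
proof -
  assume r: "r \<in> conductor n" and s: "s \<in> conductor n"
  have "elem_mat n (r + s) i j \<in> gen_alg n" if "i < n" "j < n" for i j
    by (rule gen_alg_sumI[of "{True, False}" "\<lambda>b. elem_mat n (if b then r else s) i j"])
      (use r s that in \<open>auto simp: conductor_def elem_mat_def\<close>)
  thus ?thesis using r s by (auto simp: conductor_def intro: wf_intros)
qed

lemma conductor_sum: "(\<And>x. x \<in> X \<Longrightarrow> f x \<in> conductor n) \<Longrightarrow> (\<Sum>x\<in>X. f x) \<in> conductor n"
  by (induction X rule: infinite_finite_induct) (auto intro: conductor_0 conductor_add)

section \<open>The radical of the conductor\<close>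

definition conductor_rad :: "nat \<Rightarrow> 'a::comm_ring_1 cpoly set" where
  "conductor_rad n = {r. wf_cpoly n r \<and> (\<exists>m. r ^ m \<in> conductor n)}"

lemma conductor_rad_mult: "wf_cpoly n a \<Longrightarrow> r \<in> conductor_rad n \<Longrightarrow> a * r \<in> conductor_rad n"
  by (auto simp: conductor_rad_def power_mult_distrib intro: wf_intros conductor_mult)

lemma conductor_rad_add:
  assumes "r \<in> conductor_rad n" "s \<in> conductor_rad n"
  shows "r + s \<in> conductor_rad n"
proof -
  obtain a b where ab: "r ^ a \<in> conductor n" "s ^ b \<in> conductor n" and wf: "wf_cpoly n r" "wf_cpoly n s"
    using assms by (auto simp: conductor_rad_def)
  have "of_nat (a + b choose k) * r ^ k * s ^ (a + b - k) \<in> conductor n" for k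
  proof (cases "k \<ge> a")
    case True
    have "of_nat (a + b choose k) * r ^ k * s ^ (a + b - k)
        = (of_nat (a + b choose k) * r ^ (k - a) * s ^ (a + b - k)) * r ^ a"
    proof -
      have "r ^ k = r ^ (k - a) * r ^ a" using True by (simp flip: power_add)
      thus ?thesis by (simp only: ac_simps)
    qed
    thus ?thesis using ab wf by (auto intro!: conductor_mult wf_intros)
  next
    case False
    have "of_nat (a + b choose k) * r ^ k * s ^ (a + b - k)
        = (of_nat (a + b choose k) * r ^ k * s ^ (a - k)) * s ^ b"
    proof -
      have "s ^ (a + b - k) = s ^ (a - k) * s ^ b" using False by (simp flip: power_add)
      thus ?thesis by (simp only: ac_simps)
    qed
    thus ?thesis using ab wf by (auto intro!: conductor_mult wf_intros)
  qed
  hence "(r + s) ^ (a + b) \<in> conductor n"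
    unfolding binomial_ring by (intro conductor_sum) auto
  thus ?thesis using wf by (auto simp: conductor_rad_def intro: wf_intros)
qed

lemma conductor_rad_0: "0 \<in> conductor_rad n"
  by (auto simp: conductor_rad_def intro!: exI[of _ 1] conductor_0)

lemma conductor_rad_sum: "(\<And>x. x \<in> X \<Longrightarrow> f x \<in> conductor_rad n) \<Longrightarrow> (\<Sum>x\<in>X. f x) \<in> conductor_rad n"
  by (induction X rule: infinite_finite_induct) (auto intro: conductor_rad_0 conductor_rad_add)

lemma mult_mat_entry:
  "A \<in> carrier_mat n n \<Longrightarrow> B \<in> carrier_mat n n \<Longrightarrow> i < n \<Longrightarrow> j < n \<Longrightarrow>
    (A * B) $$ (i,j) = (\<Sum>l<n. A $$ (i,l) * B $$ (l,j))"
  by (auto simp: scalar_prod_def lessThan_atLeast0 intro!: sum.cong)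

text \<open>The hypothesis says that the operator \<open>y \<mapsto> \<Sum>t. U t * y * V t\<close> maps every matrix to a
  scalar one, namely to the trace of \<open>y * e\<close> with \<open>e $$ (b,a) = d a b\<close>. Contracting the tensor
  in the other way gives \<open>z * e = \<Sum>t. trace (z * V t) * U t\<close>, so the left ideal of all matrices
  generated by \<open>e\<close> lies in the algebra of generic matrices. Hence the entries of \<open>e * y * e\<close> lie in the
  conductor, and \<open>y * e\<close> has square zero modulo the conductor.\<close>

lemma scalar_operator_trace_mem:
  fixes U V :: "'i \<Rightarrow> 'a::comm_ring_1 cpoly mat"
  assumes n: "n \<ge> 1"
    and U: "\<And>t. t \<in> T \<Longrightarrow> U t \<in> gen_alg n" and V: "\<And>t. t \<in> T \<Longrightarrow> V t \<in> gen_alg n"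
    and rel: "\<And>p q a b. p < n \<Longrightarrow> q < n \<Longrightarrow> a < n \<Longrightarrow> b < n \<Longrightarrow>
        (\<Sum>t\<in>T. U t $$ (p,a) * V t $$ (b,q)) = (if p = q then d a b else 0)"
    and y: "y \<in> gen_alg n"
  shows "(\<Sum>a<n. \<Sum>b<n. y $$ (a,b) * d a b) \<in> conductor_rad n"
proof -
  define e where "e = mat n n (\<lambda>(b,a). d a b)"
  have e: "e \<in> carrier_mat n n" by (simp add: e_def)
  have ee: "e $$ (b,a) = d a b" if "a < n" "b < n" for a b using that by (simp add: e_def)
  note Uc = gen_alg_carrier[OF U] and Vc = gen_alg_carrier[OF V] and yc = gen_alg_carrier[OF y]
  have wfd: "wf_cpoly n (d a b)" if "a < n" "b < n" for a b
  proof -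
    \<comment> \<open>The diagonal position 0 exists because n \<ge> 1; reading the relation there
      expresses \<open>d a b\<close> by entries of generic elements.\<close>
    have "d a b = (\<Sum>t\<in>T. U t $$ (0,a) * V t $$ (b,0))" using rel[of 0 0 a b] n that by simp
    thus ?thesis using n that by (auto intro!: wf_intros gen_alg_wf U V)
  qed
  \<comment> \<open>\<open>R i j\<close> is the matrix unit at (i,j) times \<open>e\<close>. It is
    obtained from the relation by letting the entry (j,i) of \<open>V t\<close> act as a coefficient
    of \<open>U t\<close>.\<close>
  define R where "R = (\<lambda>i j. mat n n (\<lambda>(p,q). if p = i then e $$ (j,q) else 0))"
  have Rc: "R i j \<in> carrier_mat n n" for i j by (simp add: R_def)
  have R: "R i j \<in> gen_alg n" if ij: "i < n" "j < n" for i j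
  proof (rule gen_alg_sumI[of T "\<lambda>t. V t $$ (j,i) \<cdot>\<^sub>m U t"])
    fix t assume "t \<in> T"
    thus "V t $$ (j,i) \<cdot>\<^sub>m U t \<in> gen_alg n" using ij by (intro gen_alg_smult gen_alg_wf U V)
  next
    fix p q assume pq: "p < n" "q < n"
    have "(\<Sum>t\<in>T. (V t $$ (j,i) \<cdot>\<^sub>m U t) $$ (p,q)) = (\<Sum>t\<in>T. U t $$ (p,q) * V t $$ (j,i))"
    proof (rule sum.cong)
      fix t assume "t \<in> T"
      with Uc[OF this] pq show "(V t $$ (j,i) \<cdot>\<^sub>m U t) $$ (p,q) = U t $$ (p,q) * V t $$ (j,i)"
        by (simp add: mult.commute)
    qed simp
    thus "R i j $$ (p,q) = (\<Sum>t\<in>T. (V t $$ (j,i) \<cdot>\<^sub>m U t) $$ (p,q))"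
      using rel[OF pq(1) ij(1) pq(2) ij(2)] pq ij by (simp add: R_def ee)
  qed (rule Rc)
  \<comment> \<open>The matrix unit at (i,j), scaled by the entry (a,b) of \<open>e * y * e\<close>,
    is the sum over \<open>t\<close> of \<open>R i a * y * V t\<close> with coefficients
    \<open>U t $$ (j,b)\<close>: the relation replaces the sum over \<open>t\<close> by the missing
    right factor \<open>e\<close>.\<close>
  have eye: "(\<Sum>l<n. \<Sum>m<n. e $$ (a,l) * y $$ (l,m) * e $$ (m,b)) \<in> conductor n" (is "?x \<in> _")
    if ab: "a < n" "b < n" for a b
  proof -
    have "elem_mat n ?x i j \<in> gen_alg n" if ij: "i < n" "j < n" for i j
    proof (rule gen_alg_sumI[of T "\<lambda>t. U t $$ (j,b) \<cdot>\<^sub>m (R i a * (y * V t))"])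
      fix t assume "t \<in> T"
      thus "U t $$ (j,b) \<cdot>\<^sub>m (R i a * (y * V t)) \<in> gen_alg n"
        using ij ab by (intro gen_alg_smult gen_alg_mult gen_alg_wf U V R y)
    next
      fix p q assume pq: "p < n" "q < n"
      have "(U t $$ (j,b) \<cdot>\<^sub>m (R i a * (y * V t))) $$ (p,q) =
          (if p = i then \<Sum>l<n. \<Sum>m<n. e $$ (a,l) * y $$ (l,m) * (U t $$ (j,b) * V t $$ (m,q)) else 0)"
        if t: "t \<in> T" for t
      proof -
        have yV: "y * V t \<in> carrier_mat n n" using yc Vc[OF t] by auto
        have "(U t $$ (j,b) \<cdot>\<^sub>m (R i a * (y * V t))) $$ (p,q) = U t $$ (j,b) * (R i a * (y * V t)) $$ (p,q)"
          using pq mult_carrier_mat[OF Rc[of i a] yV] by (intro index_smult_mat) auto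
        also have "(R i a * (y * V t)) $$ (p,q) = (\<Sum>l<n. R i a $$ (p,l) * (\<Sum>m<n. y $$ (l,m) * V t $$ (m,q)))"
          using pq by (simp add: mult_mat_entry[OF Rc yV] mult_mat_entry[OF yc Vc[OF t]])
        finally show ?thesis
          using pq by (auto simp: R_def sum_distrib_left ac_simps intro!: sum.cong)
      qed
      hence "(\<Sum>t\<in>T. (U t $$ (j,b) \<cdot>\<^sub>m (R i a * (y * V t))) $$ (p,q)) =
        (\<Sum>t\<in>T. if p = i then \<Sum>l<n. \<Sum>m<n. e $$ (a,l) * y $$ (l,m) * (U t $$ (j,b) * V t $$ (m,q)) else 0)"
        by (rule sum.cong[OF refl])
      also have "\<dots> = (if p = i then \<Sum>l<n. \<Sum>m<n. e $$ (a,l) * y $$ (l,m) * (\<Sum>t\<in>T. U t $$ (j,b) * V t $$ (m,q)) else 0)"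
      proof (cases "p = i")
        case True
        have "(\<Sum>t\<in>T. \<Sum>l<n. \<Sum>m<n. e $$ (a,l) * y $$ (l,m) * (U t $$ (j,b) * V t $$ (m,q)))
           = (\<Sum>l<n. \<Sum>t\<in>T. \<Sum>m<n. e $$ (a,l) * y $$ (l,m) * (U t $$ (j,b) * V t $$ (m,q)))"
          by (rule sum.swap)
        also have "\<dots> = (\<Sum>l<n. \<Sum>m<n. \<Sum>t\<in>T. e $$ (a,l) * y $$ (l,m) * (U t $$ (j,b) * V t $$ (m,q)))"
          by (rule sum.cong[OF refl], rule sum.swap)
        finally show ?thesis using True by (simp add: sum_distrib_left)
      qed simp
      also have "\<dots> = (if p = i \<and> q = j then ?x else 0)"
      proof -
        have "(\<Sum>t\<in>T. U t $$ (j,b) * V t $$ (m,q)) = (if q = j then e $$ (m,b) else 0)" if "m < n" for m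
          using rel[OF ij(2) pq(2) ab(2) that] ab that by (cases "q = j") (simp_all add: ee)
        thus ?thesis by (cases "p = i"; cases "q = j") simp_all
      qed
      finally show "elem_mat n ?x i j $$ (p,q) = (\<Sum>t\<in>T. (U t $$ (j,b) \<cdot>\<^sub>m (R i a * (y * V t))) $$ (p,q))"
        using pq by (simp add: elem_mat_def)
    qed (simp add: elem_mat_def)
    moreover have "wf_cpoly n ?x"
      using ab by (auto intro!: wf_intros gen_alg_wf[OF y] simp: ee wfd)
    ultimately show ?thesis by (simp add: conductor_def)
  qed
  \<comment> \<open>\<open>G\<close> is the matrix y * e. Its square is y times e * y * e, whose
    entries lie in the conductor.\<close>
  define G where "G = (\<lambda>i j. \<Sum>l<n. y $$ (i,l) * e $$ (l,j))"
  have "(\<Sum>i<n. G i i) ^ Suc n \<in> conductor n"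
  proof (rule trace_nilpotent_mod_ideal[where S = "wf_cpoly n" and G = G])
    fix i j assume ij: "i < n" "j < n"
    show "wf_cpoly n (G i j)"
      using ij by (auto simp: G_def ee wfd intro!: wf_intros gen_alg_wf[OF y])
    have "(\<Sum>l<n. G i l * G l j) = (\<Sum>p<n. y $$ (i,p) * (\<Sum>l<n. \<Sum>m<n. e $$ (p,l) * y $$ (l,m) * e $$ (m,j)))"
    proof -
      have "(\<Sum>l<n. G i l * G l j) = (\<Sum>l<n. \<Sum>p<n. \<Sum>m<n. y $$ (i,p) * (e $$ (p,l) * y $$ (l,m) * e $$ (m,j)))"
        unfolding G_def sum_product by (simp add: ac_simps)
      also have "\<dots> = (\<Sum>p<n. \<Sum>l<n. \<Sum>m<n. y $$ (i,p) * (e $$ (p,l) * y $$ (l,m) * e $$ (m,j)))"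
        by (rule sum.swap)
      finally show ?thesis by (simp add: sum_distrib_left)
    qed
    moreover have "y $$ (i,p) * (\<Sum>l<n. \<Sum>m<n. e $$ (p,l) * y $$ (l,m) * e $$ (m,j)) \<in> conductor n"
      if "p < n" for p
      by (rule conductor_mult[OF gen_alg_wf[OF y ij(1) that] eye[OF that ij(2)]])
    ultimately show "(\<Sum>l<n. G i l * G l j) \<in> conductor n"
      by (auto intro: conductor_sum)
  qed (auto intro: wf_intros conductor_0 conductor_add conductor_mult)
  moreover have "(\<Sum>i<n. G i i) = (\<Sum>a<n. \<Sum>b<n. y $$ (a,b) * d a b)"
    by (simp add: G_def ee)
  moreover have "wf_cpoly n (\<Sum>a<n. \<Sum>b<n. y $$ (a,b) * d a b)"
    by (auto intro!: wf_intros gen_alg_wf[OF y] wfd)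
  ultimately show ?thesis by (auto simp: conductor_rad_def simp del: power_Suc)
qed

section \<open>Central polynomials, their homogeneous components and derivatives\<close>

text \<open>A polynomial is given by coefficients on words and a set of words, so that a homogeneous
  component arises by shrinking \<open>W\<close> with \<open>cf\<close> unchanged.\<close>

definition central_on :: "nat \<Rightarrow> nat list set \<Rightarrow> (nat list \<Rightarrow> 'a::comm_ring_1) \<Rightarrow> bool" where
  "central_on n W cf \<longleftrightarrow> (\<forall>A. (\<forall>k. A k \<in> carrier_mat n n) \<longrightarrow>
     (\<exists>a. \<forall>p<n. \<forall>q<n. (\<Sum>w\<in>W. cf w * word_mat n A w $$ (p,q)) = (if p = q then a else 0)))"

lemma central_onD:
  assumes "central_on n W cf" "\<And>k. A k \<in> carrier_mat n n"
  shows "p < n \<Longrightarrow> q < n \<Longrightarrow> p \<noteq> q \<Longrightarrow> (\<Sum>w\<in>W. cf w * word_mat n A w $$ (p,q)) = 0"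
    and "p < n \<Longrightarrow> q < n \<Longrightarrow> (\<Sum>w\<in>W. cf w * word_mat n A w $$ (p,p)) = (\<Sum>w\<in>W. cf w * word_mat n A w $$ (q,q))"
proof -
  have "\<exists>a. \<forall>p<n. \<forall>q<n. (\<Sum>w\<in>W. cf w * word_mat n A w $$ (p,q)) = (if p = q then a else 0)"
    using assms(1)[unfolded central_on_def, THEN spec[of _ A]] assms(2) by simp
  then obtain a where a: "\<And>p q. p < n \<Longrightarrow> q < n \<Longrightarrow>
      (\<Sum>w\<in>W. cf w * word_mat n A w $$ (p,q)) = (if p = q then a else 0)"
    by (elim exE) simp
  show "p < n \<Longrightarrow> q < n \<Longrightarrow> p \<noteq> q \<Longrightarrow> (\<Sum>w\<in>W. cf w * word_mat n A w $$ (p,q)) = 0"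
    by (simp add: a)
  show "p < n \<Longrightarrow> q < n \<Longrightarrow> (\<Sum>w\<in>W. cf w * word_mat n A w $$ (p,p)) = (\<Sum>w\<in>W. cf w * word_mat n A w $$ (q,q))"
    by (simp add: a)
qed

lemma word_mat_smult:
  fixes A :: "nat \<Rightarrow> 'a::comm_ring_1 mat"
  assumes A: "\<And>k. A k \<in> carrier_mat n n"
  shows "word_mat n (\<lambda>k. x \<cdot>\<^sub>m A k) ws = x ^ length ws \<cdot>\<^sub>m word_mat n A ws"
proof (induction ws)
  case Nil
  show ?case by auto
next
  case (Cons k ws)
  note c = A[of k] word_mat_carrier[of A n ws, OF A]
  have "x \<cdot>\<^sub>m A k * (x ^ length ws \<cdot>\<^sub>m word_mat n A ws) = x ^ Suc (length ws) \<cdot>\<^sub>m (A k * word_mat n A ws)"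
    by (subst mult_smult_distrib[OF smult_carrier_mat[OF c(1)] c(2)], subst mult_smult_assoc_mat[OF c])
      (auto simp: ac_simps)
  thus ?case by (simp add: Cons)
qed

text \<open>Scaling all matrices by \<open>x\<close> separates the words by length. The scalar value
  itself varies with \<open>x\<close>, so centrality is used as vanishing of the off-diagonal
  entries and of the differences of diagonal entries, which are linear conditions.\<close>

lemma central_on_homogeneous:
  fixes cf :: "nat list \<Rightarrow> 'a::field_char_0"
  assumes n: "n \<ge> 1" and fin: "finite W" and c: "central_on n W cf"
  shows "central_on n {w\<in>W. length w = d} cf"
  unfolding central_on_def
proof (intro allI impI)
  fix A :: "nat \<Rightarrow> 'a mat" assume A: "\<forall>k. A k \<in> carrier_mat n n"
  let ?W = "{w\<in>W. length w = d}"
  let ?f = "\<lambda>p q w. cf w * word_mat n A w $$ (p,q)"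
  have scale: "cf w * word_mat n (\<lambda>k. x \<cdot>\<^sub>m A k) w $$ (p,q) = ?f p q w * x ^ length w"
    if "p < n" "q < n" for x p q w
  proof -
    have A': "A k \<in> carrier_mat n n" for k using A by blast
    show ?thesis
      using that word_mat_dim[of A n w, OF A'] by (simp add: word_mat_smult[of A n x w, OF A'])
  qed
  have xA: "x \<cdot>\<^sub>m A k \<in> carrier_mat n n" for x k using A by auto
  have off: "(\<Sum>w\<in>?W. ?f p q w) = 0" if "p < n" "q < n" "p \<noteq> q" for p q
  proof (rule infinite_field_coeff_eq_0[OF fin])
    show "(\<Sum>w\<in>W. ?f p q w * x ^ length w) = 0" for x
      using central_onD(1)[of n W cf "\<lambda>k. x \<cdot>\<^sub>m A k", OF c xA that]
      by (simp only: scale[OF that(1,2)])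
  qed
  have diag: "(\<Sum>w\<in>?W. ?f p p w) = (\<Sum>w\<in>?W. ?f q q w)" if "p < n" "q < n" for p q
  proof -
    have "(\<Sum>w\<in>?W. ?f p p w - ?f q q w) = 0"
    proof (rule infinite_field_coeff_eq_0[OF fin])
      show "(\<Sum>w\<in>W. (?f p p w - ?f q q w) * x ^ length w) = 0" for x
        using central_onD(2)[of n W cf "\<lambda>k. x \<cdot>\<^sub>m A k", OF c xA that]
        by (simp only: scale[OF that(1,1)] scale[OF that(2,2)] left_diff_distrib sum_subtractf) simp
    qed
    thus ?thesis by (simp add: sum_subtractf)
  qed
  show "\<exists>a. \<forall>p<n. \<forall>q<n. (\<Sum>w\<in>?W. ?f p q w) = (if p = q then a else 0)"
  proof (intro exI allI impI)
    fix p q assume "p < n" "q < n"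
    thus "(\<Sum>w\<in>?W. ?f p q w) = (if p = q then \<Sum>w\<in>?W. ?f 0 0 w else 0)"
      using off[of p q] diag[of q 0] n by (cases "p = q") simp_all
  qed
qed

definition word_deriv :: "nat \<Rightarrow> (nat \<Rightarrow> 'b::comm_ring_1 mat) \<Rightarrow> nat \<Rightarrow> nat \<Rightarrow> nat \<Rightarrow> nat list \<Rightarrow> nat \<Rightarrow> nat \<Rightarrow> 'b" where
  "word_deriv n A k a b w p q = (\<Sum>r<length w. if w ! r = k
     then word_mat n A (take r w) $$ (p,a) * word_mat n A (drop (Suc r) w) $$ (b,q) else 0)"

text \<open>\<open>word_deriv\<close> is the coefficient of \<open>t\<close> when the matrix unit at position \<open>(a,b)\<close>, multiplied by \<open>t\<close>,
  is added to the \<open>k\<close>-th matrix.\<close>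

lemma word_deriv_coeff:
  fixes A :: "nat \<Rightarrow> 'a::comm_ring_1 mat" and k :: nat
  assumes A: "\<And>k. A k \<in> carrier_mat n n" and ab: "a < n" "b < n"
  defines "B \<equiv> \<lambda>j. mat n n (\<lambda>(p,q). [: A j $$ (p,q), if j = k \<and> p = a \<and> q = b then 1 else 0 :])"
  assumes pq: "p < n" "q < n"
  shows "coeff (word_mat n B w $$ (p,q)) 0 = word_mat n A w $$ (p,q)"
    and "coeff (word_mat n B w $$ (p,q)) 1 = word_deriv n A k a b w p q"
proof -
  have B: "B j \<in> carrier_mat n n" for j by (simp add: B_def)
  have "\<forall>p<n. coeff (word_mat n B w $$ (p,q)) 0 = word_mat n A w $$ (p,q) \<and>
    coeff (word_mat n B w $$ (p,q)) 1 = word_deriv n A k a b w p q"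
  proof (induction w)
    case Nil
    show ?case using pq by (auto simp: word_deriv_def coeff_1)
  next
    case (Cons x w)
    show ?case
    proof (intro allI impI)
      fix p assume p: "p < n"
      have ent: "word_mat n B (x # w) $$ (p,q) = (\<Sum>l<n. B x $$ (p,l) * word_mat n B w $$ (l,q))"
        using p pq by (simp add: mult_mat_entry[OF B word_mat_carrier[OF B]])
      have entA: "word_mat n A (x # u) $$ (p,q) = (\<Sum>l<n. A x $$ (p,l) * word_mat n A u $$ (l,q))"
        if "q < n" for u q
        using p that by (simp add: mult_mat_entry[OF A word_mat_carrier[OF A]])
      have B0: "coeff (B x $$ (p,l)) 0 = A x $$ (p,l)"
        and B1: "coeff (B x $$ (p,l)) (Suc 0) = (if x = k \<and> p = a \<and> l = b then 1 else 0)" if "l < n" for l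
        using p that by (simp_all add: B_def)
      have c0: "coeff (word_mat n B (x # w) $$ (p,q)) 0 = word_mat n A (x # w) $$ (p,q)"
        unfolding ent entA[OF pq(2)] using Cons.IH B0 by (simp add: coeff_sum coeff_mult_0)
      have "coeff (word_mat n B (x # w) $$ (p,q)) 1
         = (\<Sum>l<n. A x $$ (p,l) * word_deriv n A k a b w l q
             + (if x = k \<and> p = a \<and> l = b then 1 else 0) * word_mat n A w $$ (l,q))"
        unfolding ent coeff_sum
      proof (rule sum.cong)
        fix l assume "l \<in> {..<n}"
        hence l: "l < n" by simp
        have "coeff (B x $$ (p,l) * word_mat n B w $$ (l,q)) 1 =
           coeff (B x $$ (p,l)) 0 * coeff (word_mat n B w $$ (l,q)) 1
           + coeff (B x $$ (p,l)) (Suc 0) * coeff (word_mat n B w $$ (l,q)) 0"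
          by (simp add: coeff_mult)
        thus "coeff (B x $$ (p,l) * word_mat n B w $$ (l,q)) 1 = A x $$ (p,l) * word_deriv n A k a b w l q
             + (if x = k \<and> p = a \<and> l = b then 1 else 0) * word_mat n A w $$ (l,q)"
          using Cons.IH l by (simp only: B0 B1)
      qed simp
      also have "\<dots> = (\<Sum>l<n. A x $$ (p,l) * word_deriv n A k a b w l q)
           + (\<Sum>l<n. if l = b then (if x = k \<and> p = a then word_mat n A w $$ (b,q) else 0) else 0)"
      proof -
        have "(\<Sum>l<n. (if x = k \<and> p = a \<and> l = b then 1 else 0) * word_mat n A w $$ (l,q)) =
          (\<Sum>l<n. if l = b then (if x = k \<and> p = a then word_mat n A w $$ (b,q) else 0) else 0)"
          by (rule sum.cong[OF refl]) simp
        thus ?thesis by (simp only: sum.distrib)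
      qed
      also have "(\<Sum>l<n. if l = b then (if x = k \<and> p = a then word_mat n A w $$ (b,q) else 0) else 0)
         = (if x = k then 1\<^sub>m n $$ (p,a) * word_mat n A w $$ (b,q) else 0)"
        using ab p by simp
      also have "(\<Sum>l<n. A x $$ (p,l) * word_deriv n A k a b w l q) =
         (\<Sum>r<length w. if w ! r = k then word_mat n A (x # take r w) $$ (p,a)
             * word_mat n A (drop (Suc r) w) $$ (b,q) else 0)"
      proof -
        let ?Y = "\<lambda>r. word_mat n A (drop (Suc r) w) $$ (b,q)"
        have "(\<Sum>l<n. A x $$ (p,l) * word_deriv n A k a b w l q) = (\<Sum>r<length w. \<Sum>l<n.
            A x $$ (p,l) * (if w ! r = k then word_mat n A (take r w) $$ (l,a) * ?Y r else 0))"
          unfolding word_deriv_def sum_distrib_left by (rule sum.swap)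
        also have "\<dots> = (\<Sum>r<length w. if w ! r = k then word_mat n A (x # take r w) $$ (p,a) * ?Y r else 0)"
        proof (rule sum.cong[OF refl])
          fix r
          show "(\<Sum>l<n. A x $$ (p,l) * (if w ! r = k then word_mat n A (take r w) $$ (l,a) * ?Y r else 0))
            = (if w ! r = k then word_mat n A (x # take r w) $$ (p,a) * ?Y r else 0)"
            by (cases "w ! r = k")
              (simp_all only: simp_thms if_True if_False entA[OF ab(1)] sum_distrib_right mult.assoc mult_zero_right sum.neutral_const)
        qed
        finally show ?thesis .
      qed
      finally have "coeff (word_mat n B (x # w) $$ (p,q)) 1 = word_deriv n A k a b (x # w) p q"
        unfolding word_deriv_def by (simp add: sum.lessThan_Suc_shift del: word_mat_Cons sum.lessThan_Suc cong: if_cong)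
      with c0 show "coeff (word_mat n B (x # w) $$ (p,q)) 0 = word_mat n A (x # w) $$ (p,q) \<and>
        coeff (word_mat n B (x # w) $$ (p,q)) 1 = word_deriv n A k a b (x # w) p q" by blast
    qed
  qed
  thus "coeff (word_mat n B w $$ (p,q)) 0 = word_mat n A w $$ (p,q)"
    and "coeff (word_mat n B w $$ (p,q)) 1 = word_deriv n A k a b w p q" using pq by auto
qed

text \<open>Adding \<open>x\<close> times a matrix unit to the matrix \<open>A k\<close> preserves
  the centrality relations for every \<open>x\<close> in the infinite field. They therefore hold
  between polynomials, and the linear coefficients are compared.\<close>

lemma central_on_deriv:
  fixes cf :: "nat list \<Rightarrow> 'a::field_char_0"
  assumes c: "central_on n W cf" and A: "\<And>k. A k \<in> carrier_mat n n" and ab: "a < n" "b < n"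
  shows "p < n \<Longrightarrow> q < n \<Longrightarrow> p \<noteq> q \<Longrightarrow> (\<Sum>w\<in>W. cf w * word_deriv n A k a b w p q) = 0"
    and "p < n \<Longrightarrow> q < n \<Longrightarrow> (\<Sum>w\<in>W. cf w * word_deriv n A k a b w p p) = (\<Sum>w\<in>W. cf w * word_deriv n A k a b w q q)"
proof -
  let ?B = "\<lambda>j. mat n n (\<lambda>(p,q). [: A j $$ (p,q), if j = k \<and> p = a \<and> q = b then 1 else 0 :])"
  define g where "g = (\<lambda>p q. \<Sum>w\<in>W. smult (cf w) (word_mat n ?B w $$ (p,q)))"
  have g1: "coeff (g p q) 1 = (\<Sum>w\<in>W. cf w * word_deriv n A k a b w p q)" if "p < n" "q < n" for p q
    unfolding g_def coeff_sum coeff_smult using word_deriv_coeff(2)[OF A ab that] by simp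
  have gx: "poly (g p q) x = (\<Sum>w\<in>W. cf w * word_mat n (\<lambda>j. map_mat (\<lambda>f. poly f x) (?B j)) w $$ (p,q))"
    if "p < n" "q < n" for p q x
  proof -
    interpret ev: comm_ring_hom "\<lambda>f. poly f x" by unfold_locales auto
    have "poly (word_mat n ?B w $$ (p,q)) x = word_mat n (\<lambda>j. map_mat (\<lambda>f. poly f x) (?B j)) w $$ (p,q)" for w
    proof -
      have c: "?B j \<in> carrier_mat n n" for j by simp
      have "map_mat (\<lambda>f. poly f x) (word_mat n ?B w) = word_mat n (\<lambda>j. map_mat (\<lambda>f. poly f x) (?B j)) w"
        by (rule ev.word_mat_hom[OF c])
      from arg_cong[OF this, of "\<lambda>M. M $$ (p,q)"] show ?thesis
        using that word_mat_dim[of ?B n w, OF c] by simp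
    qed
    thus ?thesis by (simp add: g_def poly_sum)
  qed
  have Bc: "map_mat (\<lambda>f. poly f x) (?B j) \<in> carrier_mat n n" for x j by simp
  show "(\<Sum>w\<in>W. cf w * word_deriv n A k a b w p q) = 0" if pq: "p < n" "q < n" "p \<noteq> q"
  proof -
    have "poly (g p q) x = 0" for x
      unfolding gx[OF pq(1,2)] by (rule central_onD(1)[OF c Bc pq])
    hence "g p q = 0" using poly_all_0_iff_0 by blast
    thus ?thesis using g1[OF pq(1,2)] by simp
  qed
  show "(\<Sum>w\<in>W. cf w * word_deriv n A k a b w p p) = (\<Sum>w\<in>W. cf w * word_deriv n A k a b w q q)"
    if pq: "p < n" "q < n"
  proof -
    have "poly (g p p) x = poly (g q q) x" for x
      unfolding gx[OF pq(1,1)] gx[OF pq(2,2)] by (rule central_onD(2)[OF c Bc pq])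
    hence "g p p = g q q" using poly_eq_poly_eq_iff[of "g p p" "g q q"] by blast
    thus ?thesis using g1[OF pq(1,1)] g1[OF pq(2,2)] by simp
  qed
qed

lemma ceval_word_deriv:
  fixes A :: "nat \<Rightarrow> 'a::comm_ring_1 mat"
  assumes "\<And>k. A k \<in> carrier_mat n n" "a < n" "b < n" "p < n" "q < n"
  shows "ceval A (word_deriv n (gen_mat n) k a b w p q) = word_deriv n A k a b w p q"
proof -
  have "ceval A (if P then x else 0) = (if P then ceval A x else 0)" for P x by simp
  thus ?thesis
    using assms(2-) by (simp add: word_deriv_def ceval.hom_sum ceval.hom_mult ceval_word_mat[OF assms(1)] cong: if_cong)
qed

lemma wf_word_deriv:
  "a < n \<Longrightarrow> b < n \<Longrightarrow> p < n \<Longrightarrow> q < n \<Longrightarrow>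
     wf_cpoly n (word_deriv n (gen_mat n) k a b w p q :: 'a::comm_ring_1 cpoly)"
  unfolding word_deriv_def by (auto intro!: wf_intros wf_word_mat_gen)

text \<open>Centrality concerns matrices over the base field; evaluations detect equality of
  polynomials, which carries the relations to generic matrices. The common diagonal value is named
  by the entry (0,0).\<close>

lemma central_on_generic_deriv:
  fixes cf :: "nat list \<Rightarrow> 'a::field_char_0"
  assumes n: "n \<ge> 1" and c: "central_on n W cf" and l: "a < n" "b < n" "p < n" "q < n"
  shows "(\<Sum>w\<in>W. cconst (cf w) * word_deriv n (gen_mat n) k a b w p q) =
    (if p = q then \<Sum>w\<in>W. cconst (cf w) * word_deriv n (gen_mat n) k a b w 0 0 else 0)"
    (is "?l = (if _ then ?r else 0)")
proof (cases "p = q")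
  case False
  have "?l = 0"
  proof (rule ceval_eq_0_imp[of n])
    show "wf_cpoly n ?l" using l by (auto intro!: wf_intros wf_word_deriv)
    fix A :: "nat \<Rightarrow> 'a mat" assume A: "\<And>k. A k \<in> carrier_mat n n"
    show "ceval A ?l = 0"
      using central_on_deriv(1)[where A = A and k = k, OF c A l False]
      by (simp add: ceval.hom_sum ceval.hom_mult ceval_word_deriv[OF A l])
  qed
  thus ?thesis using False by simp
next
  case True
  have n0: "0 < n" using n by simp
  have "?l - ?r = 0"
  proof (rule ceval_eq_0_imp[of n])
    show "wf_cpoly n (?l - ?r)" using l n0 by (auto intro!: wf_intros wf_word_deriv)
    fix A :: "nat \<Rightarrow> 'a mat" assume A: "\<And>k. A k \<in> carrier_mat n n"
    show "ceval A (?l - ?r) = 0"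
      using central_on_deriv(2)[where A = A and k = k, OF c A l(1,2) l(4) n0] True
      by (simp add: ceval.hom_minus ceval.hom_sum ceval.hom_mult ceval_word_deriv[OF A l(1,2) l(4) l(4)]
          ceval_word_deriv[OF A l(1,2) n0 n0])
  qed
  thus ?thesis using True by simp
qed

lemma word_mat_split:
  fixes A :: "nat \<Rightarrow> 'a::comm_ring_1 mat"
  assumes A: "\<And>k. A k \<in> carrier_mat n n" and "r < length w" and pq: "p < n" "q < n"
  shows "word_mat n A w $$ (p,q) =
    (\<Sum>a<n. \<Sum>b<n. A (w ! r) $$ (a,b) * (word_mat n A (take r w) $$ (p,a) * word_mat n A (drop (Suc r) w) $$ (b,q)))"
proof -
  let ?u = "word_mat n A (take r w)" and ?v = "word_mat n A (drop (Suc r) w)" and ?x = "A (w ! r)"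
  have c: "?u \<in> carrier_mat n n" "?v \<in> carrier_mat n n" by (auto intro: A)
  have "word_mat n A (take r w @ w ! r # drop (Suc r) w) = ?u * (?x * ?v)"
    by (simp only: word_mat_append[OF A] word_mat_Cons)
  hence "word_mat n A w = ?u * (?x * ?v)"
    by (simp only: id_take_nth_drop[OF assms(2), symmetric])
  also have "(?u * (?x * ?v)) $$ (p,q) = (\<Sum>a<n. ?u $$ (p,a) * (\<Sum>b<n. ?x $$ (a,b) * ?v $$ (b,q)))"
    using pq by (simp add: mult_mat_entry[OF c(1) mult_carrier_mat[OF A c(2)]] mult_mat_entry[OF A c(2)])
  finally show ?thesis by (simp add: sum_distrib_left ac_simps)
qed

lemma sum_rotate3:
  "(\<Sum>x\<in>X. \<Sum>y\<in>Y. \<Sum>z\<in>Z. f x y z) = (\<Sum>y\<in>Y. \<Sum>z\<in>Z. \<Sum>x\<in>X. f x y z)"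
  by (subst sum.swap, rule sum.cong[OF refl], rule sum.swap)

text \<open>Euler's formula expresses a homogeneous central polynomial by its scalar-valued derivatives.\<close>

lemma homogeneous_central_conductor_rad:
  fixes cf :: "nat list \<Rightarrow> 'a::field_char_0"
  assumes n: "n \<ge> 1" and fin: "finite W" and c: "central_on n W cf"
    and d: "d \<ge> 1" "\<And>w. w \<in> W \<Longrightarrow> length w = d"
  shows "\<exists>r\<in>conductor_rad n. \<forall>p<n. \<forall>q<n.
    (\<Sum>w\<in>W. cconst (cf w) * word_mat n (gen_mat n) w $$ (p,q)) = (if p = q then r else 0)"
proof -
  let ?X = "word_mat n (gen_mat n) :: nat list \<Rightarrow> 'a cpoly mat"
  let ?g = "gen_mat n :: nat \<Rightarrow> 'a cpoly mat"
  define dd where "dd = (\<lambda>k a b. \<Sum>w\<in>W. cconst (cf w) * word_deriv n ?g k a b w 0 0)"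
  define Ks where "Ks = \<Union>(set ` W)"
  have finK: "finite Ks" using fin by (simp add: Ks_def)
  \<comment> \<open>Euler's formula: \<open>d\<close> times a form of degree \<open>d\<close> is the
    sum of the variables times the partial derivatives.\<close>
  define r where "r = cconst (inverse (of_nat d)) * (\<Sum>k\<in>Ks. \<Sum>a<n. \<Sum>b<n. ?g k $$ (a,b) * dd k a b)"
  have rel: "(\<Sum>w\<in>W. cconst (cf w) * word_deriv n ?g k a b w p q) = (if p = q then dd k a b else 0)"
    if "a < n" "b < n" "p < n" "q < n" for k a b p q
    unfolding dd_def by (rule central_on_generic_deriv[OF n c that])
  have rad: "(\<Sum>a<n. \<Sum>b<n. ?g k $$ (a,b) * dd k a b) \<in> conductor_rad n" for k
  proof -
    \<comment> \<open>The index set runs over the occurrences of the letter \<open>k\<close> in the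
      words. Prefix and suffix of an occurrence give the two sides of the operator, and the
      coefficient is absorbed into the prefix.\<close>
    let ?T = "Sigma W (\<lambda>w. {r. r < length w \<and> w ! r = k})"
    let ?U = "\<lambda>(w,r). cconst (cf w) \<cdot>\<^sub>m ?X (take r w)" and ?V = "\<lambda>(w,r). ?X (drop (Suc r) w)"
    show ?thesis
    proof (rule scalar_operator_trace_mem[OF n, of ?T ?U ?V])
      fix p q a b assume l: "p < n" "q < n" "a < n" "b < n"
      have "(\<Sum>t\<in>?T. ?U t $$ (p,a) * ?V t $$ (b,q)) =
          (\<Sum>w\<in>W. \<Sum>r\<in>{r. r < length w \<and> w ! r = k}. cconst (cf w) * (?X (take r w) $$ (p,a) * ?X (drop (Suc r) w) $$ (b,q)))"
        using fin l by (subst sum.Sigma) (auto intro!: sum.cong[OF refl] simp: mult.assoc)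
      also have "\<dots> = (\<Sum>w\<in>W. cconst (cf w) * word_deriv n ?g k a b w p q)"
      proof (rule sum.cong)
        fix w
        have "word_deriv n ?g k a b w p q =
          (\<Sum>r\<in>{r\<in>{..<length w}. w ! r = k}. ?X (take r w) $$ (p,a) * ?X (drop (Suc r) w) $$ (b,q))"
          unfolding word_deriv_def by (rule sum.inter_filter[symmetric]) simp
        thus "(\<Sum>r\<in>{r. r < length w \<and> w ! r = k}. cconst (cf w) * (?X (take r w) $$ (p,a) * ?X (drop (Suc r) w) $$ (b,q)))
          = cconst (cf w) * word_deriv n ?g k a b w p q"
          by (simp add: sum_distrib_left)
      qed simp
      also have "\<dots> = (if p = q then dd k a b else 0)" by (rule rel) (use l in auto)
      finally show "(\<Sum>t\<in>?T. ?U t $$ (p,a) * ?V t $$ (b,q)) = (if p = q then dd k a b else 0)" .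
    qed (auto intro!: gen_alg_smult word_mat_gen_alg gen_mat_gen_alg)
  qed
  have "r \<in> conductor_rad n"
    unfolding r_def by (intro conductor_rad_mult conductor_rad_sum rad) simp
  moreover have "(\<Sum>w\<in>W. cconst (cf w) * ?X w $$ (p,q)) = (if p = q then r else 0)" (is "?s = _")
    if pq: "p < n" "q < n" for p q
  proof -
    \<comment> \<open>Each of the \<open>d\<close> positions of \<open>w\<close> can be singled out
      and gives back the same entry; the positions are then sorted by their letters.\<close>
    have euler: "of_nat d * ?X w $$ (p,q) = (\<Sum>k\<in>Ks. \<Sum>a<n. \<Sum>b<n. ?g k $$ (a,b) * word_deriv n ?g k a b w p q)"
      if w: "w \<in> W" for w
    proof -
      let ?h = "\<lambda>r a b. ?X (take r w) $$ (p,a) * ?X (drop (Suc r) w) $$ (b,q)"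
      have "of_nat d * ?X w $$ (p,q) = (\<Sum>r<length w. ?X w $$ (p,q))" using d(2)[OF w] by simp
      also have "\<dots> = (\<Sum>r<length w. \<Sum>a<n. \<Sum>b<n. ?g (w ! r) $$ (a,b) * ?h r a b)"
        by (rule sum.cong[OF refl], rule word_mat_split[OF gen_mat_carrier _ pq]) simp
      also have "\<dots> = (\<Sum>r<length w. \<Sum>k\<in>Ks. if w ! r = k then \<Sum>a<n. \<Sum>b<n. ?g k $$ (a,b) * ?h r a b else 0)"
      proof (rule sum.cong)
        fix r assume "r \<in> {..<length w}"
        hence "w ! r \<in> set w" by simp
        hence "w ! r \<in> Ks" using w unfolding Ks_def by blast
        thus "(\<Sum>a<n. \<Sum>b<n. ?g (w ! r) $$ (a,b) * ?h r a b) =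
          (\<Sum>k\<in>Ks. if w ! r = k then \<Sum>a<n. \<Sum>b<n. ?g k $$ (a,b) * ?h r a b else 0)"
          using finK by simp
      qed simp
      also have "\<dots> = (\<Sum>k\<in>Ks. \<Sum>r<length w. \<Sum>a<n. \<Sum>b<n. ?g k $$ (a,b) * (if w ! r = k then ?h r a b else 0))"
        by (subst sum.swap) (intro sum.cong[OF refl], simp)
      also have "\<dots> = (\<Sum>k\<in>Ks. \<Sum>a<n. \<Sum>b<n. \<Sum>r<length w. ?g k $$ (a,b) * (if w ! r = k then ?h r a b else 0))"
        by (rule sum.cong[OF refl], rule sum_rotate3)
      finally show ?thesis unfolding word_deriv_def sum_distrib_left .
    qed
    have "of_nat d * ?s = (\<Sum>w\<in>W. cconst (cf w) * (of_nat d * ?X w $$ (p,q)))"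
      by (simp add: sum_distrib_left ac_simps)
    also have "\<dots> = (\<Sum>w\<in>W. \<Sum>k\<in>Ks. \<Sum>a<n. \<Sum>b<n. ?g k $$ (a,b) * (cconst (cf w) * word_deriv n ?g k a b w p q))"
    proof (rule sum.cong[OF refl])
      fix w assume "w \<in> W"
      show "cconst (cf w) * (of_nat d * ?X w $$ (p,q)) =
        (\<Sum>k\<in>Ks. \<Sum>a<n. \<Sum>b<n. ?g k $$ (a,b) * (cconst (cf w) * word_deriv n ?g k a b w p q))"
        unfolding euler[OF \<open>w \<in> W\<close>] sum_distrib_left
        by (intro sum.cong[OF refl]) (simp only: ac_simps)
    qed
    also have "\<dots> = (\<Sum>k\<in>Ks. \<Sum>a<n. \<Sum>b<n. \<Sum>w\<in>W. ?g k $$ (a,b) * (cconst (cf w) * word_deriv n ?g k a b w p q))"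
      by (subst sum.swap, rule sum.cong[OF refl], rule sum_rotate3)
    also have "\<dots> = (\<Sum>k\<in>Ks. \<Sum>a<n. \<Sum>b<n. ?g k $$ (a,b) * (if p = q then dd k a b else 0))"
      using rel pq by (intro sum.cong[OF refl]) (simp add: sum_distrib_left[symmetric])
    finally have "of_nat d * ?s = (if p = q then \<Sum>k\<in>Ks. \<Sum>a<n. \<Sum>b<n. ?g k $$ (a,b) * dd k a b else 0)"
      by simp
    hence "cconst (inverse (of_nat d)) * (of_nat d * ?s) = (if p = q then r else 0)" by (simp add: r_def)
    moreover have "cconst (inverse (of_nat d :: 'a)) * of_nat d = 1"
    proof -
      have "cconst (inverse (of_nat d :: 'a)) * cconst (of_nat d) = 1"
        using d(1) by (simp flip: cconst.hom_mult)
      thus ?thesis by (simp only: cconst.hom_of_nat)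
    qed
    ultimately show ?thesis by (simp only: mult.assoc[symmetric] mult_1_left)
  qed
  ultimately show ?thesis by blast
qed

lemma in_free_alg_lookup:
  assumes "in_free_alg c"
  shows "Poly_Mapping.lookup c w = cconst (Poly_Mapping.lookup (Poly_Mapping.lookup c w) 0)"
proof (rule poly_mapping_eqI)
  fix m
  have "Poly_Mapping.keys (Poly_Mapping.lookup c w) \<subseteq> {0}" using assms by (simp add: in_free_alg_def)
  hence "Poly_Mapping.lookup (Poly_Mapping.lookup c w) m = 0" if "m \<noteq> 0"
    using that by (auto simp: in_keys_iff)
  thus "Poly_Mapping.lookup (Poly_Mapping.lookup c w) m =
      Poly_Mapping.lookup (cconst (Poly_Mapping.lookup (Poly_Mapping.lookup c w) 0)) m"
    by (cases "m = 0") (auto simp: cconst_def lookup_single when_def)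
qed

lemma in_free_alg_wf: "in_free_alg c \<Longrightarrow> wf_qpoly n c"
  unfolding wf_qpoly_iff by (subst in_free_alg_lookup) auto

text \<open>Each homogeneous component of \<open>c\<close> is central with a scalar in the radical,
  and the scalars add up. The vanishing constant term excludes degree 0, where Euler's formula says
  nothing.\<close>

lemma central_conductor_rad:
  fixes c :: "'a::field_char_0 qpoly"
  assumes n: "n \<ge> 1" and c: "central_poly n c" and c0: "Poly_Mapping.lookup c 0 = 0"
  shows "\<exists>r\<in>conductor_rad n. Phi n c = r \<cdot>\<^sub>m 1\<^sub>m n"
proof -
  define W where "W = word_list ` Poly_Mapping.keys c"
  define cf where "cf = (\<lambda>w. Poly_Mapping.lookup (Poly_Mapping.lookup c (Word w)) 0)"
  let ?X = "word_mat n (gen_mat n) :: nat list \<Rightarrow> 'a cpoly mat"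
  have free: "in_free_alg c" using c by (simp add: central_poly_def)
  have W_word: "Word (word_list w) = w" for w by (cases w) simp
  have inj: "inj_on word_list (Poly_Mapping.keys c)" by (rule inj_on_inverseI[of _ Word]) (rule W_word)
  have fin: "finite W" by (simp add: W_def)
  have look: "Poly_Mapping.lookup c w = cconst (cf (word_list w))" for w
    unfolding cf_def W_word by (rule in_free_alg_lookup[OF free])
  have Phi_c: "Phi n c $$ (p,q) = (\<Sum>w\<in>W. cconst (cf w) * ?X w $$ (p,q))" if "p < n" "q < n" for p q
    using that by (simp add: Phi_def W_def sum.reindex[OF inj] look)
  have "central_on n W cf"
    unfolding central_on_def
  proof (intro allI impI)
    fix A :: "nat \<Rightarrow> 'a mat" assume A: "\<forall>k. A k \<in> carrier_mat n n"
    then obtain a where a: "qeval n A c = a \<cdot>\<^sub>m 1\<^sub>m n" using c unfolding central_poly_def by blast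
    have "(\<Sum>w\<in>W. cf w * word_mat n A w $$ (p,q)) = (if p = q then a else 0)" if pq: "p < n" "q < n" for p q
    proof -
      have "qeval n A c $$ (p,q) = (\<Sum>w\<in>W. cf w * word_mat n A w $$ (p,q))"
        using pq by (simp add: qeval_def W_def sum.reindex[OF inj] look)
      thus ?thesis using pq by (cases "p = q") (simp_all add: a)
    qed
    thus "\<exists>a. \<forall>p<n. \<forall>q<n. (\<Sum>w\<in>W. cf w * word_mat n A w $$ (p,q)) = (if p = q then a else 0)" by blast
  qed
  note hom = central_on_homogeneous[OF n fin this]
  have pos: "d \<ge> 1" if d: "d \<in> length ` W" for d
  proof -
    obtain w where w: "w \<in> Poly_Mapping.keys c" "d = length (word_list w)" using d by (auto simp: W_def)
    have "word_list w \<noteq> []"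
    proof
      assume "word_list w = []"
      hence "w = 0" using W_word[of w] by (simp add: zero_word_def)
      thus False using w(1) c0 by (simp add: in_keys_iff)
    qed
    thus ?thesis using w(2) by (cases "word_list w") auto
  qed
  have "\<forall>d\<in>length ` W. \<exists>r. r \<in> conductor_rad n \<and> (\<forall>p<n. \<forall>q<n.
    (\<Sum>w\<in>{w\<in>W. length w = d}. cconst (cf w) * ?X w $$ (p,q)) = (if p = q then r else 0))"
  proof
    fix d assume d: "d \<in> length ` W"
    have "\<exists>r\<in>conductor_rad n. \<forall>p<n. \<forall>q<n.
      (\<Sum>w\<in>{w\<in>W. length w = d}. cconst (cf w) * ?X w $$ (p,q)) = (if p = q then r else 0)"
      by (rule homogeneous_central_conductor_rad[OF n _ hom[of d] pos[OF d]]) (use fin in simp_all)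
    thus "\<exists>r. r \<in> conductor_rad n \<and> (\<forall>p<n. \<forall>q<n.
      (\<Sum>w\<in>{w\<in>W. length w = d}. cconst (cf w) * ?X w $$ (p,q)) = (if p = q then r else 0))"
      unfolding Bex_def .
  qed
  from bchoice[OF this] obtain rr where "\<forall>d\<in>length ` W. rr d \<in> conductor_rad n \<and> (\<forall>p<n. \<forall>q<n.
    (\<Sum>w\<in>{w\<in>W. length w = d}. cconst (cf w) * ?X w $$ (p,q)) = (if p = q then rr d else 0))" ..
  hence rr: "\<And>d. d \<in> length ` W \<Longrightarrow> rr d \<in> conductor_rad n"
    "\<And>d p q. d \<in> length ` W \<Longrightarrow> p < n \<Longrightarrow> q < n \<Longrightarrow>
      (\<Sum>w\<in>{w\<in>W. length w = d}. cconst (cf w) * ?X w $$ (p,q)) = (if p = q then rr d else 0)"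
    by blast+
  define r where "r = (\<Sum>d\<in>length ` W. rr d)"
  have "r \<in> conductor_rad n" unfolding r_def by (intro conductor_rad_sum rr)
  moreover have "Phi n c = r \<cdot>\<^sub>m 1\<^sub>m n"
  proof (rule eq_matI)
    fix p q assume "p < dim_row (r \<cdot>\<^sub>m 1\<^sub>m n)" "q < dim_col (r \<cdot>\<^sub>m 1\<^sub>m n)"
    hence pq: "p < n" "q < n" by auto
    have "Phi n c $$ (p,q) = (\<Sum>d\<in>length ` W. \<Sum>w\<in>{w\<in>W. length w = d}. cconst (cf w) * ?X w $$ (p,q))"
      unfolding Phi_c[OF pq] by (rule sum.group[symmetric]) (use fin in auto)
    also have "\<dots> = (\<Sum>d\<in>length ` W. if p = q then rr d else 0)"
      by (rule sum.cong[OF refl], rule rr(2)) (use pq in auto)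
    finally show "Phi n c $$ (p,q) = (r \<cdot>\<^sub>m 1\<^sub>m n) $$ (p,q)" using pq by (simp add: r_def)
  qed auto
  ultimately show ?thesis by blast
qed

section \<open>Annihilation of quasi-identities\<close>

text \<open>Horner's scheme at a fixed \<open>h\<close>. Coefficients are central, so this is
  multiplicative although quasi-polynomials do not commute, and values at the same \<open>h\<close>
  commute exactly.\<close>

definition qpoly_eval :: "'a::comm_ring_1 qpoly \<Rightarrow> 'a cpoly poly \<Rightarrow> 'a qpoly" where
  "qpoly_eval h p = fold_coeffs (\<lambda>a q. qconst a + h * q) p 0"

lemma qpoly_eval_0 [simp]: "qpoly_eval h 0 = 0"
  by (simp add: qpoly_eval_def)

lemma qpoly_eval_pCons: "qpoly_eval h (pCons a p) = qconst a + h * qpoly_eval h p"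
  by (cases "p = 0 \<and> a = 0") (auto simp: qpoly_eval_def)

lemma qpoly_eval_add: "qpoly_eval h (p + q) = qpoly_eval h p + qpoly_eval h q"
proof (induction p arbitrary: q)
  case (pCons a p)
  show ?case
    by (cases q) (simp add: qpoly_eval_pCons pCons.IH qconst.hom_add ring_distribs)
qed simp

lemma qpoly_eval_smult: "qpoly_eval h (smult a p) = qconst a * qpoly_eval h p"
proof (induction p)
  case (pCons b p)
  thus ?case
    by (simp add: qpoly_eval_pCons qconst.hom_mult ring_distribs qconst_left_commute[of h])
qed simp

lemma qpoly_eval_mult: "qpoly_eval h (p * q) = qpoly_eval h p * qpoly_eval h q"
proof (induction p)
  case (pCons a p)
  thus ?case
    by (simp add: qpoly_eval_pCons qpoly_eval_add qpoly_eval_smult ring_distribs mult.assoc)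
qed simp

lemma qpoly_eval_1 [simp]: "qpoly_eval h 1 = 1"
  by (simp add: one_pCons qpoly_eval_pCons)

lemma qpoly_eval_power: "qpoly_eval h (p ^ m) = qpoly_eval h p ^ m"
  by (induction m) (simp_all add: qpoly_eval_mult)

lemma wf_qpoly_eval_linear: "wf_qpoly n h \<Longrightarrow> wf_cpoly n a \<Longrightarrow> wf_qpoly n (qpoly_eval h [:a, 1:])"
  by (auto simp: qpoly_eval_pCons intro!: wf_intros)

lemma wf_qpoly_eval_prod:
  "(\<And>x. x \<in> X \<Longrightarrow> wf_qpoly n (qpoly_eval h (f x))) \<Longrightarrow> wf_qpoly n (qpoly_eval h (\<Prod>x\<in>X. f x))"
  by (induction X rule: infinite_finite_induct) (auto simp: qpoly_eval_mult intro: wf_qpoly_mult)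

lemma Phi_qpoly_eval_diag:
  assumes h: "\<And>i j. i < n \<Longrightarrow> j < n \<Longrightarrow> Phi n h $$ (i,j) = (if i = j then \<mu> i else 0)"
    and ij: "i < n" "j < n"
  shows "Phi n (qpoly_eval h p) $$ (i,j) = (if i = j then poly p (\<mu> i) else 0)"
proof (induction p)
  case (pCons a p)
  have "(Phi n h * Phi n (qpoly_eval h p)) $$ (i,j) = (\<Sum>l<n. (if l = i then \<mu> i * Phi n (qpoly_eval h p) $$ (i,j) else 0))"
    unfolding mult_mat_entry[OF Phi_carrier Phi_carrier ij]
    by (rule sum.cong[OF refl]) (use h ij in auto)
  also have "\<dots> = \<mu> i * Phi n (qpoly_eval h p) $$ (i,j)" using ij by simp
  finally show ?case using ij pCons.IH
    by (simp add: qpoly_eval_pCons Phi_add Phi_mult Phi_qconst)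
qed (use ij in simp)

section \<open>Scaled matrix units\<close>

lemma elem_mat_carrier [simp]: "elem_mat n r i j \<in> carrier_mat n n"
  by (simp add: elem_mat_def)

lemma elem_mat_mult:
  fixes r t :: "'b::comm_ring_1"
  assumes "j < n"
  shows "elem_mat n r i j * elem_mat n t j k = elem_mat n (r * t) i k"
proof (rule eq_matI)
  fix p q assume "p < dim_row (elem_mat n (r * t) i k)" "q < dim_col (elem_mat n (r * t) i k)"
  hence pq: "p < n" "q < n" by (auto simp: elem_mat_def)
  have "(elem_mat n r i j * elem_mat n t j k) $$ (p,q) =
     (\<Sum>l<n. if l = j then (if p = i \<and> q = k then r * t else 0) else 0)"
    unfolding mult_mat_entry[OF elem_mat_carrier elem_mat_carrier pq]
    by (rule sum.cong[OF refl]) (use pq in \<open>auto simp: elem_mat_def\<close>)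
  thus "(elem_mat n r i j * elem_mat n t j k) $$ (p,q) = elem_mat n (r * t) i k $$ (p,q)"
    using assms pq by (simp add: elem_mat_def)
qed (auto simp: elem_mat_def)

lemma elem_mat_mult_0:
  fixes r t :: "'b::comm_ring_1"
  assumes "j \<noteq> j'"
  shows "elem_mat n r i j * elem_mat n t j' k = 0\<^sub>m n n"
proof (rule eq_matI)
  fix p q assume "p < dim_row (0\<^sub>m n n :: 'b mat)" "q < dim_col (0\<^sub>m n n :: 'b mat)"
  hence pq: "p < n" "q < n" by auto
  have "(elem_mat n r i j * elem_mat n t j' k) $$ (p,q) = (\<Sum>l<n. 0)"
    unfolding mult_mat_entry[OF elem_mat_carrier elem_mat_carrier pq]
    by (rule sum.cong[OF refl]) (use pq assms in \<open>auto simp: elem_mat_def\<close>)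
  thus "(elem_mat n r i j * elem_mat n t j' k) $$ (p,q) = 0\<^sub>m n n $$ (p,q)"
    using pq by simp
qed (auto simp: elem_mat_def)

lemma smult_elem_mat: "a \<cdot>\<^sub>m elem_mat n r i j = elem_mat n (a * r) i j" for a r :: "'b::comm_ring_1"
  by (rule eq_matI) (auto simp: elem_mat_def)

lemma mtrace_elem_mat: "i < n \<Longrightarrow> mtrace n (elem_mat n r i i) = r"
proof -
  assume i: "i < n"
  have "mtrace n (elem_mat n r i i) = (\<Sum>l<n. if l = i then r else 0)"
    unfolding mtrace_def by (rule sum.cong[OF refl]) (auto simp: elem_mat_def)
  thus ?thesis using i by simp
qed

text \<open>If \<open>qconst x - e\<close> is nil modulo an ideal, a power of \<open>x\<close>
  becomes a right multiple of \<open>e\<close> there. This trades a factor \<open>e\<close> for a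
  power of \<open>x\<close>.\<close>

lemma power_split_left:
  fixes e :: "'a::comm_ring_1 qpoly"
  assumes "wf_qpoly n e" "wf_cpoly n x"
  shows "\<exists>r. wf_qpoly n r \<and> qconst (x ^ m) = (qconst x - e) ^ m + e * r"
proof (induction m)
  case 0
  show ?case by (rule exI[of _ 0]) simp
next
  case (Suc m)
  let ?D = "qconst x - e"
  obtain r where r: "wf_qpoly n r" "qconst (x ^ m) = ?D ^ m + e * r" using Suc by blast
  have "qconst (x ^ Suc m) = qconst x * ?D ^ m + qconst x * (e * r)"
    by (simp only: power_Suc qconst.hom_mult r(2) ring_distribs)
  also have "qconst x * ?D ^ m = ?D ^ Suc m + e * ?D ^ m" by (simp add: ring_distribs)
  also have "qconst x * (e * r) = e * (qconst x * r)" by (rule qconst_left_commute[symmetric])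
  finally have "qconst (x ^ Suc m) = ?D ^ Suc m + e * (?D ^ m + qconst x * r)"
    by (simp add: ring_distribs)
  moreover have "wf_qpoly n (?D ^ m + qconst x * r)" using assms r(1) by (auto intro!: wf_intros)
  ultimately show ?case by blast
qed

lemma power_split_right:
  fixes e :: "'a::comm_ring_1 qpoly"
  assumes "wf_qpoly n e" "wf_cpoly n x"
  shows "\<exists>r. wf_qpoly n r \<and> qconst (x ^ m) = (qconst x - e) ^ m + r * e"
proof (induction m)
  case 0
  show ?case by (rule exI[of _ 0]) simp
next
  case (Suc m)
  let ?D = "qconst x - e"
  obtain r where r: "wf_qpoly n r" "qconst (x ^ m) = ?D ^ m + r * e" using Suc by blast
  have "qconst (x ^ Suc m) = ?D ^ m * qconst x + qconst x * (r * e)"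
    by (simp only: power_Suc qconst.hom_mult r(2) ring_distribs qconst_commute[of "?D ^ m"])
  also have "?D ^ m * qconst x = ?D ^ Suc m + ?D ^ m * e"
    unfolding power_Suc2 by (simp add: right_diff_distrib)
  finally have "qconst (x ^ Suc m) = ?D ^ Suc m + (?D ^ m + qconst x * r) * e"
    by (simp add: ring_distribs mult.assoc)
  moreover have "wf_qpoly n (?D ^ m + qconst x * r)" using assms r(1) by (auto intro!: wf_intros)
  ultimately show ?case by blast
qed

lemma Phi_mult_eq_0_left: "Phi n p = 0\<^sub>m n n \<Longrightarrow> Phi n (p * q) = 0\<^sub>m n n"
  by (simp add: Phi_mult left_mult_zero_mat[OF Phi_carrier])

lemma Phi_mult_eq_0_right: "Phi n q = 0\<^sub>m n n \<Longrightarrow> Phi n (p * q) = 0\<^sub>m n n"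
  by (simp add: Phi_mult right_mult_zero_mat[OF Phi_carrier])

text \<open>The lifts \<open>E i j\<close> of scaled matrix units multiply correctly only modulo the kernel of
  \<open>Phi\<close>. The elements \<open>\<epsilon> i\<close> built from them by interpolation are orthogonal modulo the
  Cayley--Hamilton ideal itself, because the kernel is nil.\<close>

lemma orthogonal_lifts:
  fixes s :: "'a::field_char_0 cpoly" and E :: "nat \<Rightarrow> nat \<Rightarrow> 'a qpoly"
  assumes n: "n \<ge> 1" and s: "wf_cpoly n s"
    and wfE: "\<And>i j. i < n \<Longrightarrow> j < n \<Longrightarrow> wf_qpoly n (E i j)"
    and E: "\<And>i j. i < n \<Longrightarrow> j < n \<Longrightarrow> Phi n (E i j) = elem_mat n s i j"
  obtains \<epsilon> :: "nat \<Rightarrow> 'a qpoly" and L :: nat where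
    "\<And>i. i < n \<Longrightarrow> wf_qpoly n (\<epsilon> i)"
    "\<And>i. i < n \<Longrightarrow> Phi n (\<epsilon> i) = elem_mat n (s ^ L) i i"
    "\<And>i j. i < n \<Longrightarrow> j < n \<Longrightarrow> i \<noteq> j \<Longrightarrow> \<epsilon> i * \<epsilon> j \<in> CH_ideal n"
proof -
  \<comment> \<open>The image of \<open>h\<close> is diagonal with entries l * s. All interpolants
    are polynomials in this one element, so they commute on the nose and not merely modulo the
    kernel.\<close>
  define h where "h = (\<Sum>l<n. qconst (of_nat l) * E l l)"
  define lin where "lin = (\<lambda>j::nat. [: - (of_nat j * s), 1 :])"
  \<comment> \<open>The exponent \<open>n\<close> is the nil exponent from
    \<open>ker_Phi_nil\<close>: it lets the product of two different interpolants contain the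
    \<open>n\<close>-th power of the product of all \<open>lin j\<close>.\<close>
  define R where "R = (\<lambda>X. \<Prod>j\<in>{..<n} - X. lin j ^ n)"
  define f :: "nat \<Rightarrow> 'a" where "f = (\<lambda>i. \<Prod>j\<in>{..<n} - {i}. (of_nat i - of_nat j) ^ n)"
  define \<epsilon> where "\<epsilon> = (\<lambda>i. qpoly_eval h (smult (cconst (inverse (f i))) (R {i})))"
  \<comment> \<open>At the node i * s each of the n - 1 factors \<open>lin j ^ n\<close> gives s ^ n
    times a constant; \<open>f i\<close> collects the constants.\<close>
  define L where "L = n * (n - 1)"
  have wfh: "wf_qpoly n h" unfolding h_def by (auto intro!: wf_intros wfE)
  have Phi_h: "Phi n h $$ (i,j) = (if i = j then of_nat i * s else 0)" if ij: "i < n" "j < n" for i j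
  proof -
    have "Phi n h $$ (i,j) = (\<Sum>l<n. if l = i then (if i = j then of_nat i * s else 0) else 0)"
      unfolding h_def Phi_sum_entry[OF ij]
    proof (rule sum.cong[OF refl])
      fix l assume "l \<in> {..<n}"
      thus "Phi n (qconst (of_nat l) * E l l) $$ (i,j) = (if l = i then (if i = j then of_nat i * s else 0) else 0)"
        using ij by (simp add: Phi_qconst_mult E smult_elem_mat) (auto simp: elem_mat_def)
    qed
    thus ?thesis using ij by simp
  qed
  have Phi_eval: "Phi n (qpoly_eval h f) $$ (i,j) = (if i = j then poly f (of_nat i * s) else 0)"
    if "i < n" "j < n" for f i j
    by (rule Phi_qpoly_eval_diag[where \<mu> = "\<lambda>i. of_nat i * s", OF Phi_h that])
  have wf_lin: "wf_qpoly n (qpoly_eval h (lin j))" for j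
    unfolding lin_def by (intro wf_qpoly_eval_linear wfh wf_intros s)
  have wf_R: "wf_qpoly n (qpoly_eval h (R X))" for X
    unfolding R_def by (intro wf_qpoly_eval_prod) (simp add: qpoly_eval_power wf_qpoly_power wf_lin)
  have wf\<epsilon>: "wf_qpoly n (\<epsilon> i)" for i
    unfolding \<epsilon>_def qpoly_eval_smult by (intro wf_qpoly_mult wf_R) simp
  have fnz: "f i \<noteq> 0" for i unfolding f_def by (auto simp: prod_zero_iff)
  have val: "poly (smult (cconst (inverse (f i))) (R {i})) (of_nat l * s) = (if l = i then s ^ L else 0)"
    if "i < n" "l < n" for i l
  proof (cases "l = i")
    case True
    have "poly (R {i}) (of_nat i * s) = (\<Prod>j\<in>{..<n} - {i}. cconst ((of_nat i - of_nat j) ^ n) * s ^ n)"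
      unfolding R_def poly_prod
    proof (rule prod.cong[OF refl])
      fix j
      have "poly (lin j) (of_nat i * s) = cconst (of_nat i - of_nat j) * s"
        by (simp add: lin_def cconst.hom_minus cconst.hom_of_nat left_diff_distrib)
      thus "poly (lin j ^ n) (of_nat i * s) = cconst ((of_nat i - of_nat j) ^ n) * s ^ n"
        by (simp add: power_mult_distrib cconst.hom_power)
    qed
    also have "\<dots> = cconst (f i) * s ^ L"
      using that by (simp add: prod.distrib f_def cconst.hom_prod L_def power_mult)
    finally have "poly (R {i}) (of_nat i * s) = cconst (f i) * s ^ L" .
    moreover have "cconst (inverse (f i)) * (cconst (f i) * s ^ L) = s ^ L"
    proof -
      have "cconst (inverse (f i)) * cconst (f i) = 1" using fnz[of i] by (simp flip: cconst.hom_mult)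
      thus ?thesis by (simp flip: mult.assoc)
    qed
    ultimately show ?thesis using True by simp
  next
    case False
    have "poly (R {i}) (of_nat l * s) = 0"
      unfolding R_def poly_prod
      by (rule prod_zero) (use that False n in \<open>auto intro!: bexI[of _ l] simp: lin_def power_0_left\<close>)
    thus ?thesis using False by simp
  qed
  have Phi\<epsilon>: "Phi n (\<epsilon> i) = elem_mat n (s ^ L) i i" if i: "i < n" for i
  proof (rule eq_matI)
    fix p q assume "p < dim_row (elem_mat n (s ^ L) i i)" "q < dim_col (elem_mat n (s ^ L) i i)"
    hence pq: "p < n" "q < n" by (auto simp: elem_mat_def)
    have "Phi n (\<epsilon> i) $$ (p,q) = (if p = q then if p = i then s ^ L else 0 else 0)"
      unfolding \<epsilon>_def Phi_eval[OF pq] val[OF i pq(1)] ..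
    thus "Phi n (\<epsilon> i) $$ (p,q) = elem_mat n (s ^ L) i i $$ (p,q)"
      using pq by (auto simp: elem_mat_def)
  qed (auto simp: elem_mat_def)
  let ?\<Psi> = "\<Prod>j<n. lin j"
  have wf\<Psi>: "wf_qpoly n (qpoly_eval h ?\<Psi>)" by (intro wf_qpoly_eval_prod wf_lin)
  have "Phi n (qpoly_eval h ?\<Psi>) = 0\<^sub>m n n"
  proof (rule eq_matI)
    fix p q assume "p < dim_row (0\<^sub>m n n :: 'a cpoly mat)" "q < dim_col (0\<^sub>m n n :: 'a cpoly mat)"
    hence pq: "p < n" "q < n" by auto
    have "poly ?\<Psi> (of_nat p * s) = 0"
      unfolding poly_prod by (rule prod_zero) (use pq in \<open>auto intro!: bexI[of _ p] simp: lin_def\<close>)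
    thus "Phi n (qpoly_eval h ?\<Psi>) $$ (p,q) = 0\<^sub>m n n $$ (p,q)"
      using pq by (cases "p = q") (simp_all add: Phi_eval)
  qed auto
  from ker_Phi_nil[OF wf\<Psi> this] have nil: "qpoly_eval h (?\<Psi> ^ n) \<in> CH_ideal n"
    by (simp add: qpoly_eval_power)
  have orth: "\<epsilon> i * \<epsilon> j \<in> CH_ideal n" if ij: "i < n" "j < n" "i \<noteq> j" for i j
  proof -
    \<comment> \<open>\<open>R {j}\<close> contains \<open>lin i ^ n\<close>, exactly the factor
      that \<open>R {i}\<close> lacks to be the nil power of the full product.\<close>
    have Rj: "R {j} = lin i ^ n * R {i,j}"
    proof -
      have "R {j} = lin i ^ n * (\<Prod>l\<in>{..<n} - {j} - {i}. lin l ^ n)"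
        unfolding R_def by (rule prod.remove) (use ij in auto)
      moreover have "{..<n} - {j} - {i} = {..<n} - {i,j}" by auto
      ultimately show ?thesis by (simp add: R_def)
    qed
    have "(\<Prod>l<n. lin l ^ n) = lin i ^ n * R {i}"
      unfolding R_def by (rule prod.remove) (use ij in auto)
    hence \<Psi>: "?\<Psi> ^ n = lin i ^ n * R {i}" by (simp add: prod_power_distrib)
    let ?a = "cconst (inverse (f i))" and ?b = "cconst (inverse (f j))"
    have "\<epsilon> i * \<epsilon> j = qpoly_eval h (smult ?a (R {i}) * smult ?b (R {j}))"
      by (simp only: \<epsilon>_def qpoly_eval_mult)
    also have "smult ?a (R {i}) * smult ?b (R {j}) = smult (?a * ?b) (?\<Psi> ^ n * R {i,j})"
      unfolding Rj \<Psi> by (simp add: ac_simps)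
    also have "qpoly_eval h \<dots> = qconst (?a * ?b) * (qpoly_eval h (?\<Psi> ^ n) * qpoly_eval h (R {i,j}))"
      by (simp only: qpoly_eval_smult qpoly_eval_mult)
    also have "\<dots> \<in> CH_ideal n"
      by (rule T_ideal.lmult[OF _ T_ideal.rmult[OF wf_R nil]]) (auto intro!: wf_intros)
    finally show ?thesis .
  qed
  show ?thesis by (rule that[of \<epsilon> L]) (use wf\<epsilon> Phi\<epsilon> orth in auto)
qed

text \<open>The sum of the \<open>\<epsilon> i\<close> and the sum of their squares act as powers of
  \<open>s\<close> up to errors that are nil modulo the ideal. It suffices to multiply
  \<open>e * k * e'\<close> into the ideal, block by block, and then to trade \<open>e\<close> and
  \<open>e'\<close> for powers of \<open>s\<close>.\<close>

lemma ker_Phi_killed: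
  fixes s :: "'a::field_char_0 cpoly" and E :: "nat \<Rightarrow> nat \<Rightarrow> 'a qpoly"
  assumes n: "n \<ge> 1" and s: "wf_cpoly n s"
    and wfE: "\<And>i j. i < n \<Longrightarrow> j < n \<Longrightarrow> wf_qpoly n (E i j)"
    and E: "\<And>i j. i < n \<Longrightarrow> j < n \<Longrightarrow> Phi n (E i j) = elem_mat n s i j"
    and k: "wf_qpoly n k" "Phi n k = 0\<^sub>m n n"
  shows "\<exists>N. qconst (s ^ N) * k \<in> CH_ideal n"
proof -
  let ?I = "CH_ideal n :: 'a qpoly set"
  obtain \<epsilon> :: "nat \<Rightarrow> 'a qpoly" and L where
    wf\<epsilon>: "\<And>i. i < n \<Longrightarrow> wf_qpoly n (\<epsilon> i)"
    and Phi\<epsilon>: "\<And>i. i < n \<Longrightarrow> Phi n (\<epsilon> i) = elem_mat n (s ^ L) i i"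
    and orth: "\<And>i j. i < n \<Longrightarrow> j < n \<Longrightarrow> i \<noteq> j \<Longrightarrow> \<epsilon> i * \<epsilon> j \<in> ?I"
    using orthogonal_lifts[OF n s wfE E] by metis
  \<comment> \<open>There are n - 1 traces, each equal to s ^ L.\<close>
  define a where "a = L * (n - 1)"
  \<comment> \<open>The image of \<open>g * g'\<close> below is s ^ (4 * L + 2) times a matrix unit,
    of which \<open>\<epsilon> j * \<epsilon> j\<close> accounts for s ^ (2 * L).\<close>
  define b where "b = L + L + 2"
  have corner: "qconst (s ^ a) * k' \<in> ?I"
    if i: "i < n" and k': "wf_qpoly n k'" "Phi n k' = 0\<^sub>m n n"
      and ann: "\<And>l. l < n \<Longrightarrow> l \<noteq> i \<Longrightarrow> k' * \<epsilon> l \<in> ?I \<and> \<epsilon> l * k' \<in> ?I" for i k'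
  proof -
    let ?\<tau> = "transpose 0 i"
    \<comment> \<open>The transposition of 0 and \<open>i\<close> puts the n - 1 elements
      \<open>\<epsilon> l\<close> with l \<noteq> i into the slots 1, ..., n - 1 and leaves slot 0
      to \<open>k'\<close>.\<close>
    define H where "H = (\<lambda>l. if l = 0 then k' else if l < n then \<epsilon> (?\<tau> l) else 0)"
    have \<tau>: "?\<tau> l < n" "?\<tau> l \<noteq> i" if "l \<in> {1..<n}" for l
      using that i by (auto simp: transpose_def)
    have \<tau>_inj: "?\<tau> l \<noteq> ?\<tau> l'" if "l \<noteq> l'" for l l'
      using that by (metis transpose_involutory)
    have H: "H l = \<epsilon> (?\<tau> l)" if "l \<in> {1..<n}" for l using that by (simp add: H_def)
    have H0: "H 0 = k'" by (simp add: H_def)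
    have tr: "mtrace n (Phi n (H l)) = s ^ L" if "l \<in> {1..<n}" for l
      unfolding H[OF that] Phi\<epsilon>[OF \<tau>(1)[OF that]] by (rule mtrace_elem_mat[OF \<tau>(1)[OF that]])
    have "qconst (\<Prod>l\<in>{1..<n}. mtrace n (Phi n (H l))) * H 0 \<in> ?I"
    proof (rule ker_Phi_annihilated[OF n])
      show "wf_qpoly n (H l)" for l
      proof (cases "l \<in> {1..<n}")
        case True
        show ?thesis unfolding H[OF True] by (rule wf\<epsilon>[OF \<tau>(1)[OF True]])
      next
        case False
        hence "H l = k' \<or> H l = 0" using n by (auto simp: H_def)
        thus ?thesis using k' by auto
      qed
      show "Phi n (H 0) = 0\<^sub>m n n" using k' by (simp add: H0)
    next
      fix l l' assume l: "l \<in> {1..<n}" "l' \<in> {1..<n}" "l \<noteq> l'"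
      show "Phi n (H l) * Phi n (H l') = 0\<^sub>m n n"
        unfolding H[OF l(1)] H[OF l(2)] Phi\<epsilon>[OF \<tau>(1)[OF l(1)]] Phi\<epsilon>[OF \<tau>(1)[OF l(2)]]
        by (rule elem_mat_mult_0[OF \<tau>_inj[OF l(3)]])
    next
      fix l assume l: "l \<in> {1..<n}"
      show "H 0 * H l \<in> ?I \<and> H l * H 0 \<in> ?I"
        unfolding H[OF l] H0 by (rule ann[OF \<tau>[OF l]])
    qed
    moreover have "(\<Prod>l\<in>{1..<n}. mtrace n (Phi n (H l))) = s ^ a"
      by (simp add: tr a_def power_mult)
    ultimately show ?thesis by (simp only: H0)
  qed
  \<comment> \<open>The factor \<open>g\<close> leads from \<open>j\<close> to \<open>i\<close> and
    closes \<open>\<epsilon> i * k\<close> to a diagonal corner at \<open>i\<close>;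
    \<open>g'\<close> leads back to \<open>j\<close>.\<close>
  have block: "qconst (s ^ (a + b)) * (\<epsilon> i * k * (\<epsilon> j * \<epsilon> j)) \<in> ?I"
    if ij: "i < n" "j < n" and k: "wf_qpoly n k" "Phi n k = 0\<^sub>m n n" for i j k
  proof -
    note wf = wf\<epsilon>[OF ij(1)] wf\<epsilon>[OF ij(2)] wfE[OF ij] wfE[OF ij(2,1)] k(1)
    define k1 where "k1 = \<epsilon> i * k"
    define g where "g = \<epsilon> j * E j i * \<epsilon> i"
    define g' where "g' = \<epsilon> i * E i j * \<epsilon> j"
    have wfk1: "wf_qpoly n k1" unfolding k1_def by (intro wf_intros wf)
    have wfg: "wf_qpoly n g" "wf_qpoly n g'" unfolding g_def g'_def by (intro wf_intros wf)+
    have 1: "qconst (s ^ a) * (k1 * g) \<in> ?I"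
    proof (rule corner[OF ij(1)])
      show "wf_qpoly n (k1 * g)" by (intro wf_intros wfk1 wfg)
      show "Phi n (k1 * g) = 0\<^sub>m n n"
        unfolding k1_def by (intro Phi_mult_eq_0_left Phi_mult_eq_0_right k)
      fix l assume l: "l < n" "l \<noteq> i"
      have "(k1 * (\<epsilon> j * E j i)) * (\<epsilon> i * \<epsilon> l) \<in> ?I"
        by (rule T_ideal.lmult[OF _ orth[OF ij(1) l(1) l(2)[symmetric]]]) (intro wf_intros wf wfk1)
      moreover have "(\<epsilon> l * \<epsilon> i) * (k * g) \<in> ?I"
        by (rule T_ideal.rmult[OF _ orth[OF l(1) ij(1) l(2)]]) (intro wf_intros wf wfg)
      ultimately show "k1 * g * \<epsilon> l \<in> ?I \<and> \<epsilon> l * (k1 * g) \<in> ?I"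
        by (simp add: k1_def g_def mult.assoc)
    qed
    \<comment> \<open>The error of the round trip lies in the kernel. Both of its terms begin and
      end with \<open>\<epsilon> j\<close>, so it is again a diagonal corner, now at
      \<open>j\<close>.\<close>
    define d where "d = g * g' - qconst (s ^ b) * (\<epsilon> j * \<epsilon> j)"
    have 2: "qconst (s ^ a) * d \<in> ?I"
    proof (rule corner[OF ij(2)])
      show "wf_qpoly n d" unfolding d_def by (auto intro!: wf_intros wf wfg s)
      have "Phi n (g * g') = elem_mat n (s ^ b * (s ^ L * s ^ L)) j j"
        unfolding g_def g'_def Phi_mult Phi\<epsilon>[OF ij(1)] Phi\<epsilon>[OF ij(2)] E[OF ij] E[OF ij(2,1)]
          elem_mat_mult[OF ij(1)] elem_mat_mult[OF ij(2)]
        by (simp add: b_def power_add power2_eq_square ac_simps)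
      moreover have "Phi n (qconst (s ^ b) * (\<epsilon> j * \<epsilon> j)) = elem_mat n (s ^ b * (s ^ L * s ^ L)) j j"
        unfolding Phi_qconst_mult Phi_mult[of n "\<epsilon> j"] Phi\<epsilon>[OF ij(2)] elem_mat_mult[OF ij(2)] smult_elem_mat ..
      ultimately show "Phi n d = 0\<^sub>m n n"
        unfolding d_def Phi_minus by (simp add: minus_r_inv_mat[OF elem_mat_carrier])
      fix l assume l: "l < n" "l \<noteq> j"
      note o1 = orth[OF ij(2) l(1) l(2)[symmetric]] and o2 = orth[OF l(1) ij(2) l(2)]
      have "(g * (\<epsilon> i * E i j)) * (\<epsilon> j * \<epsilon> l) - qconst (s ^ b) * (\<epsilon> j * (\<epsilon> j * \<epsilon> l)) \<in> ?I"
        by (intro T_ideal_minus T_ideal.lmult[OF _ T_ideal.lmult[OF _ o1]] T_ideal.lmult[OF _ o1])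
          (auto intro!: wf_intros wf wfg s)
      moreover have "(\<epsilon> l * \<epsilon> j) * (E j i * \<epsilon> i * g') - qconst (s ^ b) * ((\<epsilon> l * \<epsilon> j) * \<epsilon> j) \<in> ?I"
        by (intro T_ideal_minus T_ideal.lmult[OF _ T_ideal.rmult[OF _ o2]] T_ideal.rmult[OF _ o2])
          (auto intro!: wf_intros wf wfg s)
      ultimately show "d * \<epsilon> l \<in> ?I \<and> \<epsilon> l * d \<in> ?I"
        by (simp add: d_def g_def g'_def left_diff_distrib right_diff_distrib mult.assoc
            qconst_left_commute[of "\<epsilon> l"])
    qed
    have "qconst (s ^ (a + b)) * (k1 * (\<epsilon> j * \<epsilon> j)) =
        (qconst (s ^ a) * (k1 * g)) * g' - k1 * (qconst (s ^ a) * d)"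
      by (simp add: d_def right_diff_distrib mult.assoc power_add qconst.hom_mult
          qconst_left_commute[of k1])
    moreover have "\<dots> \<in> ?I"
      by (intro T_ideal_minus T_ideal.rmult[OF wfg(2) 1] T_ideal.lmult[OF wfk1 2])
    ultimately show ?thesis by (simp add: k1_def mult.assoc)
  qed
  define e where "e = (\<Sum>i<n. \<epsilon> i)"
  define e' where "e' = (\<Sum>j<n. \<epsilon> j * \<epsilon> j)"
  have wfe: "wf_qpoly n e" "wf_qpoly n e'" unfolding e_def e'_def by (auto intro!: wf_intros wf\<epsilon>)
  have sum_elem: "(\<Sum>i<n. elem_mat n r i i $$ (p,q)) = (r \<cdot>\<^sub>m 1\<^sub>m n) $$ (p,q)" if pq: "p < n" "q < n"
    for p q and r :: "'a cpoly"
  proof -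
    have "(\<Sum>i<n. elem_mat n r i i $$ (p,q)) = (\<Sum>i<n. if i = p then (if p = q then r else 0) else 0)"
      by (rule sum.cong[OF refl]) (use pq in \<open>auto simp: elem_mat_def\<close>)
    thus ?thesis using pq by simp
  qed
  have nil: "(qconst (s ^ L) - e) ^ n \<in> ?I"
  proof (rule ker_Phi_nil)
    show "wf_qpoly n (qconst (s ^ L) - e)" by (auto intro!: wf_intros wfe s)
    have "Phi n e = s ^ L \<cdot>\<^sub>m 1\<^sub>m n"
      by (rule eq_matI) (auto simp: e_def Phi_sum_entry Phi\<epsilon> sum_elem)
    thus "Phi n (qconst (s ^ L) - e) = 0\<^sub>m n n"
      unfolding Phi_minus Phi_qconst by (simp add: minus_r_inv_mat[of _ n n])
  qed
  have nil': "(qconst (s ^ L * s ^ L) - e') ^ n \<in> ?I"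
  proof (rule ker_Phi_nil)
    show "wf_qpoly n (qconst (s ^ L * s ^ L) - e')" by (auto intro!: wf_intros wfe s)
    have "Phi n e' = (s ^ L * s ^ L) \<cdot>\<^sub>m 1\<^sub>m n"
      by (rule eq_matI) (auto simp: e'_def Phi_sum_entry Phi_mult Phi\<epsilon> elem_mat_mult sum_elem)
    thus "Phi n (qconst (s ^ L * s ^ L) - e') = 0\<^sub>m n n"
      unfolding Phi_minus Phi_qconst by (simp add: minus_r_inv_mat[of _ n n])
  qed
  have all: "qconst (s ^ (a + b)) * (e * k * e') \<in> ?I" if "wf_qpoly n k" "Phi n k = 0\<^sub>m n n" for k
  proof -
    have "qconst (s ^ (a + b)) * (e * k * e') = (\<Sum>i<n. \<Sum>j<n. qconst (s ^ (a + b)) * (\<epsilon> i * k * (\<epsilon> j * \<epsilon> j)))"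
      unfolding e_def e'_def sum_distrib_right sum_distrib_left by (rule sum.swap)
    also have "\<dots> \<in> ?I" by (intro T_ideal_sum block that) auto
    finally show ?thesis .
  qed
  define c1 where "c1 = s ^ (a + b)"
  define c2 where "c2 = (s ^ L) ^ n"
  define c3 where "c3 = (s ^ L * s ^ L) ^ n"
  have wfc: "wf_cpoly n c1" "wf_cpoly n c2" "wf_cpoly n c3"
    unfolding c1_def c2_def c3_def by (intro wf_intros s)+
  \<comment> \<open>The nil part of \<open>qconst c2\<close> falls into the ideal. The other part
    supplies the left factor \<open>e\<close>, and \<open>all\<close> is applied to
    \<open>r * k\<close>, still in the kernel.\<close>
  have right: "qconst (c1 * c2) * (k * e') \<in> ?I" if k: "wf_qpoly n k" "Phi n k = 0\<^sub>m n n" for k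
  proof -
    obtain r where r: "wf_qpoly n r" "qconst c2 = (qconst (s ^ L) - e) ^ n + e * r"
      using power_split_left[OF wfe(1) wf_cpoly_power[OF s]] unfolding c2_def by blast
    have "qconst (c1 * c2) * (k * e') =
        qconst c1 * ((qconst (s ^ L) - e) ^ n * (k * e')) + qconst c1 * (e * (r * k) * e')"
      unfolding qconst.hom_mult r(2) by (simp only: ring_distribs mult.assoc)
    also have "\<dots> \<in> ?I"
    proof (rule T_ideal.add)
      show "qconst c1 * ((qconst (s ^ L) - e) ^ n * (k * e')) \<in> ?I"
        by (rule T_ideal.lmult[OF _ T_ideal.rmult[OF _ nil]]) (auto intro: wf_intros wfc k wfe)
      show "qconst c1 * (e * (r * k) * e') \<in> ?I"
        unfolding c1_def by (intro all wf_intros r k Phi_mult_eq_0_right)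
    qed
    finally show ?thesis .
  qed
  obtain r where r: "wf_qpoly n r" "qconst c3 = (qconst (s ^ L * s ^ L) - e') ^ n + r * e'"
    using power_split_right[OF wfe(2) wf_cpoly_mult[OF wf_cpoly_power[OF s] wf_cpoly_power[OF s]]]
    unfolding c3_def by blast
  have "qconst (c1 * c2 * c3) * k = qconst (c1 * c2) * (k * qconst c3)"
    by (simp only: qconst.hom_mult mult.assoc qconst_commute[of k])
  also have "\<dots> = qconst (c1 * c2) * (k * (qconst (s ^ L * s ^ L) - e') ^ n) + qconst (c1 * c2) * ((k * r) * e')"
    unfolding r(2) by (simp only: ring_distribs mult.assoc)
  also have "\<dots> \<in> ?I"
  proof (rule T_ideal.add)
    show "qconst (c1 * c2) * (k * (qconst (s ^ L * s ^ L) - e') ^ n) \<in> ?I"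
      by (rule T_ideal.lmult[OF _ T_ideal.lmult[OF _ nil']]) (auto intro: wf_intros wfc k)
    show "qconst (c1 * c2) * ((k * r) * e') \<in> ?I"
      by (intro right wf_intros r k Phi_mult_eq_0_left)
  qed
  finally have "qconst (c1 * c2 * c3) * k \<in> ?I" .
  moreover have "c1 * c2 * c3 = s ^ (a + b + L * n + (L * n + L * n))"
    by (simp only: c1_def c2_def c3_def power_add power_mult power_mult_distrib ac_simps)
  ultimately show ?thesis by metis
qed

section \<open>From powers of the scalar to powers of the central polynomial\<close>

theorem mainTheorem6:
  fixes n :: nat and P c :: "'a::field_char_0 qpoly"
  assumes "n \<ge> 1"
    and "wf_qpoly n P"
    and "quasi_identity n P"
    and "central_poly n c"
    and "Poly_Mapping.lookup c 0 = 0"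
  shows "\<exists>m::nat. c ^ m * P \<in> T_ideal n {Q_CH n}"
proof -
  let ?I = "CH_ideal n :: 'a qpoly set"
  obtain r where r: "r \<in> conductor_rad n" and Phi_c: "Phi n c = r \<cdot>\<^sub>m 1\<^sub>m n"
    using central_conductor_rad[OF assms(1,4,5)] by blast
  then obtain M where wfr: "wf_cpoly n r" and M: "r ^ M \<in> conductor n"
    by (auto simp: conductor_rad_def)
  have "\<forall>i j. \<exists>p. i < n \<longrightarrow> j < n \<longrightarrow> wf_qpoly n p \<and> Phi n p = elem_mat n (r ^ M) i j"
    using M by (fastforce simp: conductor_def gen_alg_def)
  then obtain E where E: "\<And>i j. i < n \<Longrightarrow> j < n \<Longrightarrow> wf_qpoly n (E i j) \<and> Phi n (E i j) = elem_mat n (r ^ M) i j"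
    by metis
  have "\<exists>N. qconst ((r ^ M) ^ N) * P \<in> ?I"
    by (rule ker_Phi_killed[of n "r ^ M" E])
      (use assms E wfr quasi_identity_imp_Phi_0 in \<open>auto intro: wf_intros\<close>)
  then obtain N where "qconst ((r ^ M) ^ N) * P \<in> ?I" by blast
  then obtain N where N: "qconst r ^ N * P \<in> ?I"
    by (metis power_mult qconst.hom_power)
  have wfc: "wf_qpoly n c" using assms(4) by (auto simp: central_poly_def intro: in_free_alg_wf)
  define \<kappa> where "\<kappa> = c - qconst r"
  have wf\<kappa>: "wf_qpoly n \<kappa>" unfolding \<kappa>_def using wfc wfr by (auto intro: wf_intros)
  have "Phi n \<kappa> = 0\<^sub>m n n"
    unfolding \<kappa>_def Phi_minus Phi_c Phi_qconst by (simp add: minus_r_inv_mat[of _ n n])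
  from ker_Phi_nil[OF wf\<kappa> this] have nil: "\<kappa> ^ n \<in> ?I" .
  \<comment> \<open>Since the ideal is two-sided, the nil power of \<kappa> may be followed by
    anything and \<open>qconst r ^ N * P\<close> may be preceded by anything.\<close>
  have big: "\<kappa> ^ x * (qconst r ^ y * P) \<in> ?I" if "x \<ge> n \<or> y \<ge> N" for x y
    using that
  proof
    assume "x \<ge> n"
    hence "\<kappa> ^ x = \<kappa> ^ n * \<kappa> ^ (x - n)" by (simp flip: power_add)
    hence "\<kappa> ^ x * (qconst r ^ y * P) = \<kappa> ^ n * (\<kappa> ^ (x - n) * (qconst r ^ y * P))"
      by (simp only: mult.assoc)
    also have "\<dots> \<in> ?I"
      by (rule T_ideal.rmult[OF _ nil]) (auto intro!: wf_intros wf\<kappa> assms(2) simp: wfr)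
    finally show ?thesis .
  next
    assume "y \<ge> N"
    hence "qconst r ^ y = qconst r ^ (y - N) * qconst r ^ N" by (simp flip: power_add)
    hence "\<kappa> ^ x * (qconst r ^ y * P) = \<kappa> ^ x * qconst r ^ (y - N) * (qconst r ^ N * P)"
      by (simp only: mult.assoc)
    also have "\<dots> \<in> ?I"
      by (rule T_ideal.lmult[OF _ N]) (auto intro!: wf_intros wf\<kappa> simp: wfr)
    finally show ?thesis .
  qed
  \<comment> \<open>Each factor \<open>c\<close> is replaced by \<kappa> + r, raising one of the two
    exponents. Once all factors are spent, x + y \<ge> n + N forces x \<ge> n or y \<ge> N.\<close>
  have "c ^ m * (\<kappa> ^ x * (qconst r ^ y * P)) \<in> ?I" if "m + x + y \<ge> n + N" for m x y
    using that
  proof (induction m arbitrary: x y)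
    case 0
    hence "\<kappa> ^ x * (qconst r ^ y * P) \<in> ?I" by (intro big) linarith
    thus ?case by simp
  next
    case (Suc m)
    have "c ^ Suc m * (\<kappa> ^ x * (qconst r ^ y * P)) = c ^ m * ((\<kappa> + qconst r) * (\<kappa> ^ x * (qconst r ^ y * P)))"
      by (simp add: power_Suc2 mult.assoc \<kappa>_def del: power_Suc)
    also have "\<dots> = c ^ m * (\<kappa> ^ Suc x * (qconst r ^ y * P)) + c ^ m * (\<kappa> ^ x * (qconst r ^ Suc y * P))"
      by (simp only: ring_distribs power_Suc mult.assoc qconst_left_commute[of "\<kappa> ^ x", symmetric])
    also have "\<dots> \<in> ?I"
      by (rule T_ideal.add; rule Suc.IH) (use Suc.prems in simp_all)
    finally show ?case .
  qed
  from this[of "n + N" 0 0] show ?thesis by (auto intro!: exI[of _ "n + N"])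
qed

end
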